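(* Let $N=\sum_{i=1}^m N_i$, with $N\ge 3$, $m\ge 1$ and $N_i\ge 2$ for all $1\le i\le m$, and write $\mathbb{R}^N=\mathbb{R}^{N_1}\times\cdots\times\mathbb{R}^{N_m}$. Then the space $$\mathcal{D}^{1,2}_s(\mathbb{R}^N):=\Big\{u\in\mathcal{D}^{1,2}(\mathbb{R}^N)\ \Big|\ \forall i\in\{1,\ldots,m\},\ \forall x_k^0\in\mathbb{R}^{N_k}\ (k\ne i):\ u(x_1^0,\ldots,x_{i-1}^0,\,\cdot\,,x_{i+1}^0,\ldots,x_m^0)\text{ is radial}\Big\}$$ is compactly embedded in $L^p+L^q(\mathbb{R}^N)$, for all $1<p<2^*<q$, where $2^*=2N/(N-2)$.
   Context: Functions are real-valued and identified when equal almost everywhere (so the radiality requirement means that $u$ has a representative satisfying it). $\mathcal{D}^{1,2}(\mathbb{R}^N)$ is the completion of $C_0^\infty(\mathbb{R}^N)$ with respect to the norm $\|u\|=\left(\int_{\mathbb{R}^N}|\nabla u|^2\,dx\right)^{1/2}$; $\mathcal{D}^{1,2}_s(\mathbb{R}^N)$ carries this norm. $L^p+L^q(\mathbb{R}^N)$ is the Banach space of functions $v=v_1+v_2$ with $v_1\in L^p(\mathbb{R}^N)$, $v_2\in L^q(\mathbb{R}^N)$, with norm $\|v\|_{L^p+L^q}=\inf\{\|v_1\|_{L^p}+\|v_2\|_{L^q}\mid v_1\in L^p,\,v_2\in L^q,\,v_1+v_2=v\}$. *)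

theory Defs
  imports "HOL-Analysis.Analysis"
begin

section \<open>Test functions\<close>

primrec C_k :: "nat \<Rightarrow> (real^'n \<Rightarrow> real) \<Rightarrow> bool" where
  "C_k 0 f \<longleftrightarrow> continuous_on UNIV f"
| "C_k (Suc k) f \<longleftrightarrow> (\<forall>x. f differentiable (at x)) \<and>
     (\<forall>i. C_k k (\<lambda>x. frechet_derivative f (at x) (axis i 1)))"

definition C0_infty :: "(real^'n \<Rightarrow> real) set" where
  "C0_infty = {f. (\<forall>k. C_k k f) \<and> compact (closure {x. f x \<noteq> 0})}"

definition grad :: "(real^'n \<Rightarrow> real) \<Rightarrow> real^'n \<Rightarrow> real^'n" where
  "grad f x = (\<chi> i. frechet_derivative f (at x) (axis i 1))"

definition grad_norm :: "(real^'n \<Rightarrow> real) \<Rightarrow> real" where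
  "grad_norm f = sqrt (LINT x|lebesgue. (norm (grad f x))\<^sup>2)"


section \<open>Lebesgue spaces and their sums\<close>

text \<open>
  All function spaces below are sets of Lebesgue measurable representatives that are closed under
  changes on null sets, and the norms on them depend on the almost-everywhere class only.
\<close>

definition Lp :: "real \<Rightarrow> (real^'n \<Rightarrow> real) set" where
  "Lp p = {f \<in> borel_measurable lebesgue. integrable lebesgue (\<lambda>x. \<bar>f x\<bar> powr p)}"

definition Lp_norm :: "real \<Rightarrow> (real^'n \<Rightarrow> real) \<Rightarrow> real" where
  "Lp_norm p f = (LINT x|lebesgue. \<bar>f x\<bar> powr p) powr (1 / p)"

definition Lp_decomp :: "real \<Rightarrow> real \<Rightarrow> (real^'n \<Rightarrow> real) \<Rightarrow>
    ((real^'n \<Rightarrow> real) \<times> (real^'n \<Rightarrow> real)) set" where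
  "Lp_decomp p q v =
     {(v1, v2). v1 \<in> Lp p \<and> v2 \<in> Lp q \<and> (AE x in lebesgue. v x = v1 x + v2 x)}"

definition Lp_sum :: "real \<Rightarrow> real \<Rightarrow> (real^'n \<Rightarrow> real) set" where
  "Lp_sum p q = {v \<in> borel_measurable lebesgue. Lp_decomp p q v \<noteq> {}}"

definition Lp_sum_norm :: "real \<Rightarrow> real \<Rightarrow> (real^'n \<Rightarrow> real) \<Rightarrow> real" where
  "Lp_sum_norm p q v = (INF (v1, v2) \<in> Lp_decomp p q v. Lp_norm p v1 + Lp_norm q v2)"


section \<open>The space \<open>D\<^sup>1\<^sup>,\<^sup>2\<close>\<close>

definition critical_exp :: "nat \<Rightarrow> real" where
  "critical_exp N = 2 * real N / (real N - 2)"

text \<open>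
  Elements of the completion of \<^term>\<open>C0_infty\<close> are classes of gradient-Cauchy sequences of test
  functions. For dimension at least 3, the Sobolev inequality makes such a sequence converge in
  \<open>L\<close> with the critical exponent, and two such sequences are equivalent iff they have the same limit
  almost everywhere. As usual, the completion is therefore realised as the space of these limits;
  \<open>D12_approx \<phi> u\<close> says that the Cauchy sequence \<open>\<phi>\<close> represents \<open>u\<close>. The norm is the extension
  of the gradient norm to the completion: the common limit of \<open>grad_norm (\<phi> n)\<close> over all
  representing sequences.
\<close>

definition D12_approx :: "(nat \<Rightarrow> real^'n \<Rightarrow> real) \<Rightarrow> (real^'n \<Rightarrow> real) \<Rightarrow> bool" where
  "D12_approx \<phi> u \<longleftrightarrow>
     (\<forall>n. \<phi> n \<in> C0_infty) \<and>
     (\<forall>e>0. \<exists>M. \<forall>k\<ge>M. \<forall>l\<ge>M. grad_norm (\<lambda>x. \<phi> k x - \<phi> l x) < e) \<and>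
     u \<in> Lp (critical_exp CARD('n)) \<and>
     (\<lambda>n. Lp_norm (critical_exp CARD('n)) (\<lambda>x. \<phi> n x - u x)) \<longlonglongrightarrow> 0"

definition D12 :: "(real^'n \<Rightarrow> real) set" where
  "D12 = {u. \<exists>\<phi>. D12_approx \<phi> u}"

definition D12_norm :: "(real^'n \<Rightarrow> real) \<Rightarrow> real" where
  "D12_norm u = (THE L. \<exists>\<phi>. D12_approx \<phi> u \<and> (\<lambda>n. grad_norm (\<phi> n)) \<longlonglongrightarrow> L)"


section \<open>Block-radial functions\<close>

text \<open>
  A splitting of the coordinates into blocks is encoded by a function \<open>b\<close> sending each coordinate
  index to the number of its block, so the block \<open>i\<close> is \<open>{j. b j = i}\<close>. The vector
  \<open>with_block b i y x0\<close> has block \<open>i\<close> taken from \<open>y\<close> and all other blocks from \<open>x0\<close>.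
\<close>

definition block_norm :: "('n::finite \<Rightarrow> nat) \<Rightarrow> nat \<Rightarrow> real^'n \<Rightarrow> real" where
  "block_norm b i y = L2_set (\<lambda>j. y $ j) {j. b j = i}"

definition with_block :: "('n::finite \<Rightarrow> nat) \<Rightarrow> nat \<Rightarrow> real^'n \<Rightarrow> real^'n \<Rightarrow> real^'n" where
  "with_block b i y x0 = (\<chi> j. if b j = i then y $ j else x0 $ j)"

definition block_radial :: "nat \<Rightarrow> ('n::finite \<Rightarrow> nat) \<Rightarrow> (real^'n \<Rightarrow> real) \<Rightarrow> bool" where
  "block_radial m b w \<longleftrightarrow>
     (\<forall>i\<in>{1..m}. \<forall>x0 y z. block_norm b i y = block_norm b i z \<longrightarrow>
        w (with_block b i y x0) = w (with_block b i z x0))"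

definition D12_s :: "nat \<Rightarrow> ('n::finite \<Rightarrow> nat) \<Rightarrow> (real^'n \<Rightarrow> real) set" where
  "D12_s m b = {u \<in> D12. \<exists>w. (AE x in lebesgue. w x = u x) \<and> block_radial m b w}"


section \<open>Compact embeddings\<close>

text \<open>
  The inclusion of \<open>X\<close> into \<open>Y\<close> is well defined, bounded, and maps every bounded sequence to a
  sequence with a subsequence converging in \<open>Y\<close>.
\<close>

definition compactly_embedded ::
    "('a \<Rightarrow> real) set \<Rightarrow> (('a \<Rightarrow> real) \<Rightarrow> real) \<Rightarrow>
     ('a \<Rightarrow> real) set \<Rightarrow> (('a \<Rightarrow> real) \<Rightarrow> real) \<Rightarrow> bool" where
  "compactly_embedded X normX Y normY \<longleftrightarrow>
     X \<subseteq> Y \<and>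
     (\<exists>C. \<forall>u\<in>X. normY u \<le> C * normX u) \<and>
     (\<forall>u. (\<forall>n. u n \<in> X) \<and> (\<exists>B. \<forall>n. normX (u n) \<le> B) \<longrightarrow>
        (\<exists>v\<in>Y. \<exists>r::nat \<Rightarrow> nat. strict_mono r \<and>
           (\<lambda>n. normY (\<lambda>x. u (r n) x - v x)) \<longlonglongrightarrow> 0))"

end

theory Submission
  imports Defs "HOL-Probability.Probability" "HOL-Complex_Analysis.Great_Picard"
begin

text \<open>
  Let \<open>A_s u(x)\<close> be the mean of \<open>u\<close> over the ball of radius \<open>s\<close> about \<open>x\<close>. All that is used of the gradient
  bound \<open>G\<close> is \<open>\<parallel>u(\<cdot> + h) - u\<parallel>\<^sub>2 \<le> G |h|\<close>. It gives \<open>\<parallel>u - A_s u\<parallel>\<^sub>2 \<le> G s\<close>, a Lipschitz bound for \<open>A_s u\<close> and, by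
  summing over dyadic radii, \<open>|A_s u| \<le> C G s\<^sup>1\<^sup>-\<^sup>N\<^sup>/\<^sup>2\<close>. Optimising in \<open>s\<close> yields the weak-type Sobolev inequality with
  the critical exponent, which already suffices for the embedding into \<open>L\<^sup>p + L\<^sup>q\<close> as \<open>p < 2\<^sup>* < q\<close>. Moreover, among
  functions with a common weak-type bound, convergence in measure on the whole space implies
  convergence in \<open>L\<^sup>p + L\<^sup>q\<close>.

  A block-radial \<open>u\<close> has the same integrals over many disjoint reflected copies of a ball about \<open>x\<close>
  if \<open>|x|\<close> is large (here blocks must have dimension at least 2), so \<open>A_s u(x)\<close> tends to 0 at infinity,
  uniformly on bounded sets of such functions. Hence a bounded sequence has a subsequence for which all
  \<open>A_s u\<^sub>n\<close>, \<open>s = 1, 1/2, 1/3, ...\<close>, are uniformly Cauchy on the whole space, and the subsequence is Cauchy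
  in measure because \<open>u\<^sub>n - A_s u\<^sub>n\<close> is small in \<open>L\<^sup>2\<close> for small \<open>s\<close>.
\<close>

section \<open>Means over balls\<close>

text \<open>The increment bound is the form of the gradient bound that survives almost-everywhere
  limits (by Fatou), so it passes from test functions to the completion without weak derivatives.
  Increments cannot see an added constant; integrability of a power of \<open>|u|\<close> excludes
  it by forcing the means to vanish as the radius grows, and the value of that integral enters no
  final constant. The dyadic series has ratio \<open>2 powr (1 - N / 2)\<close>, which is below 1
  exactly when \<open>N > 2\<close>. Three effects could destroy compactness. Concentration and
  spreading respect the weak-type bound, but they produce very large or very small values, and these
  are negligible because both inequalities between \<open>p\<close>, the critical exponent and
  \<open>q\<close> are strict. What remains is mass moving to infinity, which the decay of the means
  excludes. Spheres in a one-dimensional block have two points only, too few for many disjoint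
  copies.\<close>

lemma nn_integral_lborel_shift:
  fixes f :: "'a::euclidean_space \<Rightarrow> ennreal"
  assumes [measurable]: "f \<in> borel_measurable borel"
  shows "(\<integral>\<^sup>+x. f (h + x) \<partial>lborel) = (\<integral>\<^sup>+x. f x \<partial>lborel)"
proof -
  have "(\<integral>\<^sup>+x. f x \<partial>lborel) = (\<integral>\<^sup>+x. f x \<partial>distr lborel borel ((+) h))"
    by (simp add: lborel_distr_plus)
  also have "\<dots> = (\<integral>\<^sup>+x. f (h + x) \<partial>lborel)"
    by (rule nn_integral_distr) auto
  finally show ?thesis ..
qed

definition ball_measure :: "real \<Rightarrow> 'a::euclidean_space measure" where
  "ball_measure s = uniform_measure lborel (ball 0 s)"

text \<open>The operator \<open>A_s\<close> of the overview. The ball is centred at 0 and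
  \<open>x\<close> sits in the integrand, so that two means with different radii form one double
  integral over a product measure.\<close>

definition ball_mean :: "real \<Rightarrow> ('a::euclidean_space \<Rightarrow> real) \<Rightarrow> 'a \<Rightarrow> real" where
  "ball_mean s u x = (LINT y|ball_measure s. u (x + y))"

abbreviation ball_vol :: "'a::euclidean_space itself \<Rightarrow> real \<Rightarrow> real" where
  "ball_vol _ s \<equiv> unit_ball_vol (real DIM('a)) * s ^ DIM('a)"

lemma sets_ball_measure [simp, measurable_cong]: "sets (ball_measure s) = sets borel"
  by (simp add: ball_measure_def)

lemma space_ball_measure [simp]: "space (ball_measure s) = UNIV"
  by (simp add: ball_measure_def)

lemma ball_vol_pos: "0 < s \<Longrightarrow> 0 < ball_vol TYPE('a::euclidean_space) s"
  by simp

lemma prob_space_ball_measure: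
  assumes "0 < s"
  shows "prob_space (ball_measure s :: 'a::euclidean_space measure)"
proof -
  have "emeasure lborel (ball (0::'a) s) \<noteq> 0" 
    using ball_vol_pos[OF assms, where 'a='a] assms by (subst emeasure_ball) (auto simp: ennreal_eq_0_iff not_le)
  then show ?thesis unfolding ball_measure_def
    by (intro prob_space_uniform_measure) (use assms in \<open>auto simp: emeasure_ball\<close>)
qed

lemma measure_ball_measure_UNIV [simp]:
  assumes "0 < s"
  shows "emeasure (ball_measure s :: 'a::euclidean_space measure) UNIV = 1"
    and "measure (ball_measure s :: 'a::euclidean_space measure) UNIV = 1"
proof -
  interpret prob_space "ball_measure s :: 'a measure" by (rule prob_space_ball_measure[OF assms])
  show "emeasure (ball_measure s :: 'a measure) UNIV = 1" using emeasure_space_1 by simp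
  show "measure (ball_measure s :: 'a measure) UNIV = 1" using prob_space by simp
qed

lemma nn_integral_ball_measure:
  fixes f :: "'a::euclidean_space \<Rightarrow> ennreal"
  assumes "f \<in> borel_measurable borel" "0 < s"
  shows "(\<integral>\<^sup>+y. f y \<partial>ball_measure s) =
    (\<integral>\<^sup>+y. f y * indicator (ball 0 s) y \<partial>lborel) / ennreal (ball_vol TYPE('a) s)"
  unfolding ball_measure_def
  by (subst nn_integral_uniform_measure) (use assms in \<open>auto simp: emeasure_ball\<close>)

lemma nn_integral_ball_measure_le:
  fixes f :: "'a::euclidean_space \<Rightarrow> ennreal"
  assumes "f \<in> borel_measurable borel" "0 < s"
  shows "(\<integral>\<^sup>+y. f y \<partial>ball_measure s) \<le> (\<integral>\<^sup>+y. f y \<partial>lborel) / ennreal (ball_vol TYPE('a) s)"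
  unfolding nn_integral_ball_measure[OF assms]
  by (intro divide_right_mono_ennreal nn_integral_mono) (auto simp: indicator_def)

lemma AE_ball_measure: "AE y in ball_measure s. norm y < s"
  unfolding ball_measure_def by (rule AE_uniform_measureI) auto

lemma ennreal_power2_le_imp_le:
  assumes "a\<^sup>2 \<le> (ennreal b)\<^sup>2" "0 \<le> b"
  shows "a \<le> ennreal b"
proof (cases a)
  case (real r)
  then show ?thesis using assms by (auto simp: ennreal_power intro: ennreal_leI power2_le_imp_le)
next
  case top
  then show ?thesis using assms by (simp add: ennreal_power top_power_ennreal top.extremum_unique)
qed

text \<open>Cauchy-Schwarz against the constant 1, whose integral is 1: Jensen's inequality for the
  square.\<close>

lemma (in prob_space) nn_integral_power2_le:
  assumes "f \<in> borel_measurable M"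
  shows "(\<integral>\<^sup>+x. f x \<partial>M)\<^sup>2 \<le> (\<integral>\<^sup>+x. (f x)\<^sup>2 \<partial>M)"
  using Cauchy_Schwarz_nn_integral[OF assms, of "\<lambda>_. 1"] by (simp add: emeasure_space_1)

text \<open>\<open>G\<close> stands for the gradient norm and \<open>c\<close> will be the critical
  exponent. The condition \<open>integrable\<close> is qualitative: it excludes nonzero constants,
  which satisfy \<open>shift\<close> with \<open>G = 0\<close>.\<close>

locale energy_bounded =
  fixes c G :: real and u :: "'a::euclidean_space \<Rightarrow> real"
  assumes c: "1 \<le> c"
    and G: "0 \<le> G"
    and meas [measurable]: "u \<in> borel_measurable borel"
    and integrable: "integrable lborel (\<lambda>x. \<bar>u x\<bar> powr c)"
    and shift: "\<And>h. (\<integral>\<^sup>+x. ennreal ((u (x + h) - u x)\<^sup>2) \<partial>lborel) \<le> ennreal ((G * norm h)\<^sup>2)"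
begin

definition mass :: real where "mass = (LINT x|lborel. \<bar>u x\<bar> powr c)"

lemma mass_nonneg: "0 \<le> mass"
  unfolding mass_def by (rule Bochner_Integration.integral_nonneg) auto

lemma nn_integral_powr: "(\<integral>\<^sup>+x. ennreal (\<bar>u x\<bar> powr c) \<partial>lborel) = ennreal mass"
  unfolding mass_def by (rule nn_integral_eq_integral[OF integrable]) auto

text \<open>Values are split at the level \<open>d\<close>: below it \<open>t \<le> d\<close>, above
  it \<open>t \<le> d powr (1 - c) * t powr c\<close>. Keeping \<open>d\<close> free lets the bound
  tend to \<open>d\<close> as the radius grows.\<close>

lemma nn_integral_ball_measure_abs:
  assumes s: "0 < s" and d: "0 < d"
  shows "(\<integral>\<^sup>+y. ennreal \<bar>u (x + y)\<bar> \<partial>ball_measure s) \<le>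
    ennreal (d + d powr (1 - c) * (mass / ball_vol TYPE('a) s))"
proof -
  interpret prob_space "ball_measure s :: 'a measure" by (rule prob_space_ball_measure[OF s])
  have pt: "t \<le> d + d powr (1 - c) * t powr c" if "0 \<le> t" for t
  proof (cases "t \<le> d")
    case False
    then have "t powr (1 - c) \<le> d powr (1 - c)" using c d by (intro powr_mono2') auto
    then have "t powr (1 - c) * t powr c \<le> d powr (1 - c) * t powr c" by (rule mult_right_mono) simp
    moreover have "t powr (1 - c) * t powr c = t" using False d by (simp flip: powr_add)
    ultimately show ?thesis using d by simp
  qed (use d that in \<open>auto intro!: add_increasing2\<close>)
  have "(\<integral>\<^sup>+y. ennreal \<bar>u (x + y)\<bar> \<partial>ball_measure s) \<le>
      (\<integral>\<^sup>+y. ennreal d + ennreal (d powr (1 - c)) * ennreal (\<bar>u (x + y)\<bar> powr c) \<partial>ball_measure s)"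
    using pt d by (intro nn_integral_mono) (simp flip: ennreal_plus ennreal_mult add: ennreal_leI)
  also have "\<dots> = ennreal d + ennreal (d powr (1 - c)) * (\<integral>\<^sup>+y. ennreal (\<bar>u (x + y)\<bar> powr c) \<partial>ball_measure s)"
    by (subst nn_integral_add) (auto simp: nn_integral_cmult s)
  also have "(\<integral>\<^sup>+y. ennreal (\<bar>u (x + y)\<bar> powr c) \<partial>ball_measure s) \<le>
      (\<integral>\<^sup>+y. ennreal (\<bar>u (x + y)\<bar> powr c) \<partial>lborel) / ennreal (ball_vol TYPE('a) s)"
    by (rule nn_integral_ball_measure_le) (use s in auto)
  also have "\<dots> = ennreal (mass / ball_vol TYPE('a) s)"
    using nn_integral_lborel_shift[of "\<lambda>y. ennreal (\<bar>u y\<bar> powr c)" x] s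
    by (simp add: nn_integral_powr divide_ennreal mass_nonneg)
  finally show ?thesis
    using d s by (simp add: mult_left_mono add_left_mono mass_nonneg flip: ennreal_plus ennreal_mult)
qed

lemma integrable_ball_measure:
  assumes s: "0 < s"
  shows "integrable (ball_measure s) (\<lambda>y. u (x + y))"
proof (rule integrableI_bounded)
  show "(\<integral>\<^sup>+y. ennreal (norm (u (x + y))) \<partial>ball_measure s) < \<infinity>"
    using nn_integral_ball_measure_abs[OF s, of 1 x] by (simp add: less_top[symmetric] top.extremum_unique) 
       (metis ennreal_neq_top neq_top_trans)
qed simp

text \<open>Jensen moves the square inside; enlarging the ball to the whole space costs one volume,
  hence its square root here.\<close>

lemma nn_integral_shift_ball_measure:
  assumes s: "0 < s"
  shows "(\<integral>\<^sup>+y. ennreal \<bar>u (x + h + y) - u (x + y)\<bar> \<partial>ball_measure s) \<le>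
    ennreal (G * norm h / sqrt (ball_vol TYPE('a) s))"
proof -
  interpret prob_space "ball_measure s :: 'a measure" by (rule prob_space_ball_measure[OF s])
  have "(\<integral>\<^sup>+y. ennreal \<bar>u (x + h + y) - u (x + y)\<bar> \<partial>ball_measure s)\<^sup>2 \<le>
      (\<integral>\<^sup>+y. (ennreal \<bar>u (x + h + y) - u (x + y)\<bar>)\<^sup>2 \<partial>ball_measure s)"
    by (rule nn_integral_power2_le) simp
  also have "\<dots> = (\<integral>\<^sup>+y. ennreal ((u (x + y + h) - u (x + y))\<^sup>2) \<partial>ball_measure s)"
    by (simp add: ennreal_power add_ac)
  also have "\<dots> \<le> (\<integral>\<^sup>+y. ennreal ((u (x + y + h) - u (x + y))\<^sup>2) \<partial>lborel) / ennreal (ball_vol TYPE('a) s)"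
    by (rule nn_integral_ball_measure_le) (use s in auto)
  also have "(\<integral>\<^sup>+y. ennreal ((u (x + y + h) - u (x + y))\<^sup>2) \<partial>lborel) = (\<integral>\<^sup>+y. ennreal ((u (y + h) - u y)\<^sup>2) \<partial>lborel)"
    using nn_integral_lborel_shift[of "\<lambda>y. ennreal ((u (y + h) - u y)\<^sup>2)" x] by simp
  also have "\<dots> / ennreal (ball_vol TYPE('a) s) \<le> ennreal ((G * norm h)\<^sup>2) / ennreal (ball_vol TYPE('a) s)"
    by (rule divide_right_mono_ennreal[OF shift])
  also have "\<dots> = (ennreal (G * norm h / sqrt (ball_vol TYPE('a) s)))\<^sup>2"
    using s G by (simp add: divide_ennreal ennreal_power power_divide)
  finally show ?thesis
    by (rule ennreal_power2_le_imp_le) (use s G in simp)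
qed

text \<open>Equicontinuity for the compactness argument; the same bound, averaged, compares means of
  different radii.\<close>

lemma ball_mean_Lipschitz:
  assumes s: "0 < s"
  shows "\<bar>ball_mean s u (x + h) - ball_mean s u x\<bar> \<le> G * norm h / sqrt (ball_vol TYPE('a) s)"
proof -
  have "ball_mean s u (x + h) - ball_mean s u x = (LINT y|ball_measure s. u (x + h + y) - u (x + y))"
    unfolding ball_mean_def by (rule Bochner_Integration.integral_diff[symmetric]; rule integrable_ball_measure[OF s])
  also have "ennreal \<bar>\<dots>\<bar> \<le> (\<integral>\<^sup>+y. ennreal \<bar>u (x + h + y) - u (x + y)\<bar> \<partial>ball_measure s)"
    using integral_norm_bound_ennreal[of "ball_measure s" "\<lambda>y. u (x + h + y) - u (x + y)"]
      integrable_ball_measure[OF s] by simp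
  also note nn_integral_shift_ball_measure[OF s]
  finally show ?thesis using G s by (simp add: ennreal_le_iff)
qed

lemma ball_mean_measurable [measurable]: "0 < s \<Longrightarrow> ball_mean s u \<in> borel_measurable borel"
proof -
  assume s: "0 < s"
  interpret prob_space "ball_measure s :: 'a measure" by (rule prob_space_ball_measure[OF s])
  show ?thesis unfolding ball_mean_def[abs_def]
    by (rule borel_measurable_lebesgue_integral) simp
qed

text \<open>\<open>u - A_s u\<close> is an average of increments by vectors shorter than
  \<open>s\<close>; Jensen and Fubini reduce its square integral to \<open>shift\<close>.\<close>

lemma nn_integral_diff_ball_mean:
  assumes s: "0 < s"
  shows "(\<integral>\<^sup>+x. ennreal ((u x - ball_mean s u x)\<^sup>2) \<partial>lborel) \<le> ennreal ((G * s)\<^sup>2)"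
proof -
  interpret prob_space "ball_measure s :: 'a measure" by (rule prob_space_ball_measure[OF s])
  interpret pair_sigma_finite lborel "ball_measure s :: 'a measure" ..
  have "ennreal ((u x - ball_mean s u x)\<^sup>2) \<le> (\<integral>\<^sup>+y. ennreal ((u (x + y) - u x)\<^sup>2) \<partial>ball_measure s)" for x
  proof -
    have "ball_mean s u x - u x = (LINT y|ball_measure s. u (x + y) - u x)"
      unfolding ball_mean_def using integrable_ball_measure[OF s, of x]
      by (subst Bochner_Integration.integral_diff) (auto simp: s)
    then have "ennreal \<bar>u x - ball_mean s u x\<bar> \<le> (\<integral>\<^sup>+y. ennreal \<bar>u (x + y) - u x\<bar> \<partial>ball_measure s)"
      using integral_norm_bound_ennreal[of "ball_measure s" "\<lambda>y. u (x + y) - u x"]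
        integrable_ball_measure[OF s, of x]
      by (simp add: abs_minus_commute[of "u x"] del: Bochner_Integration.integral_diff)
    then have "(ennreal \<bar>u x - ball_mean s u x\<bar>)\<^sup>2 \<le> (\<integral>\<^sup>+y. ennreal \<bar>u (x + y) - u x\<bar> \<partial>ball_measure s)\<^sup>2"
      by (rule power_mono) simp
    also have "\<dots> \<le> (\<integral>\<^sup>+y. (ennreal \<bar>u (x + y) - u x\<bar>)\<^sup>2 \<partial>ball_measure s)"
      by (rule nn_integral_power2_le) simp
    finally show ?thesis by (simp add: ennreal_power)
  qed
  then have "(\<integral>\<^sup>+x. ennreal ((u x - ball_mean s u x)\<^sup>2) \<partial>lborel) \<le>
     (\<integral>\<^sup>+x. (\<integral>\<^sup>+y. ennreal ((u (x + y) - u x)\<^sup>2) \<partial>ball_measure s) \<partial>lborel)"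
    by (rule nn_integral_mono)
  also have "\<dots> = (\<integral>\<^sup>+y. (\<integral>\<^sup>+x. ennreal ((u (x + y) - u x)\<^sup>2) \<partial>lborel) \<partial>ball_measure s)"
    by (rule Fubini'[symmetric]) simp
  also have "\<dots> \<le> (\<integral>\<^sup>+y. ennreal ((G * s)\<^sup>2) \<partial>(ball_measure s :: 'a measure))"
  proof (rule nn_integral_mono_AE, rule AE_mp[OF AE_ball_measure], rule AE_I2, rule impI)
    fix y :: 'a assume "norm y < s"
    then have "(G * norm y)\<^sup>2 \<le> (G * s)\<^sup>2" using G by (intro power_mono mult_left_mono) auto
    then show "(\<integral>\<^sup>+x. ennreal ((u (x + y) - u x)\<^sup>2) \<partial>lborel) \<le> ennreal ((G * s)\<^sup>2)"
      using shift[of y] by (meson ennreal_leI order_trans)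
  qed
  also have "\<dots> = ennreal ((G * s)\<^sup>2)" by (simp add: s)
  finally show ?thesis .
qed

text \<open>Both sides integrate \<open>u (x + y + z)\<close> over the product measure. The level
  \<open>d = 1\<close> in \<open>nn_integral_ball_measure_abs\<close> gives a bound uniform in the
  centre, which justifies Fubini.\<close>

lemma ball_mean_commute:
  assumes s: "0 < s" and t: "0 < t"
  shows "(LINT y|ball_measure s. ball_mean t u (x + y)) = (LINT z|ball_measure t. ball_mean s u (x + z))"
    and "integrable (ball_measure s) (\<lambda>y. ball_mean t u (x + y))"
proof -
  interpret S: prob_space "ball_measure s :: 'a measure" by (rule prob_space_ball_measure[OF s])
  interpret T: prob_space "ball_measure t :: 'a measure" by (rule prob_space_ball_measure[OF t])
  interpret pair_sigma_finite "ball_measure s :: 'a measure" "ball_measure t :: 'a measure" ..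
  let ?f = "\<lambda>y z. u (x + y + z)"
  have int: "integrable (ball_measure s \<Otimes>\<^sub>M ball_measure t) (case_prod ?f)"
  proof (rule integrableI_bounded)
    have "(\<integral>\<^sup>+p. ennreal (norm (case_prod ?f p)) \<partial>(ball_measure s \<Otimes>\<^sub>M ball_measure t)) =
        (\<integral>\<^sup>+y. \<integral>\<^sup>+z. ennreal \<bar>u (x + y + z)\<bar> \<partial>ball_measure t \<partial>ball_measure s)"
      by (subst T.nn_integral_fst[symmetric]) auto
    also have "\<dots> \<le> (\<integral>\<^sup>+y. ennreal (1 + 1 powr (1 - c) * (mass / ball_vol TYPE('a) t)) \<partial>(ball_measure s :: 'a measure))"
      by (intro nn_integral_mono nn_integral_ball_measure_abs t) simp
    also have "\<dots> < \<infinity>" by (simp add: s)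
    finally show "(\<integral>\<^sup>+p. ennreal (norm (case_prod ?f p)) \<partial>(ball_measure s \<Otimes>\<^sub>M ball_measure t)) < \<infinity>" .
  qed simp
  show "(LINT y|ball_measure s. ball_mean t u (x + y)) = (LINT z|ball_measure t. ball_mean s u (x + z))"
    using Fubini_integral[OF int] by (simp add: ball_mean_def add_ac)
  show "integrable (ball_measure s) (\<lambda>y. ball_mean t u (x + y))"
    using integrable_fst'[OF int] by (simp add: ball_mean_def)
qed

lemma ball_mean_diff_iterated:
  assumes s: "0 < s" and t: "0 < t"
  shows "\<bar>(LINT z|ball_measure t. ball_mean s u (x + z)) - ball_mean s u x\<bar> \<le>
    G * t / sqrt (ball_vol TYPE('a) s)"
proof -
  interpret T: prob_space "ball_measure t :: 'a measure" by (rule prob_space_ball_measure[OF t])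
  have "(LINT z|ball_measure t. ball_mean s u (x + z)) - ball_mean s u x =
     (LINT z|ball_measure t. ball_mean s u (x + z) - ball_mean s u x)"
    using ball_mean_commute(2)[OF t s, of x]
    by (subst Bochner_Integration.integral_diff) (auto simp: t)
  also have "\<bar>\<dots>\<bar> \<le> (LINT z|(ball_measure t :: 'a measure). G * t / sqrt (ball_vol TYPE('a) s))"
  proof -
    have "\<bar>LINT z|ball_measure t. ball_mean s u (x + z) - ball_mean s u x\<bar> \<le>
        (LINT z|ball_measure t. \<bar>ball_mean s u (x + z) - ball_mean s u x\<bar>)"
      using integral_norm_bound[of "ball_measure t" "\<lambda>z. ball_mean s u (x + z) - ball_mean s u x"] by simp
    also have "\<dots> \<le> (LINT z|(ball_measure t :: 'a measure). G * t / sqrt (ball_vol TYPE('a) s))"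
    proof (rule Bochner_Integration.integral_mono_AE)
      show "AE z in ball_measure t. \<bar>ball_mean s u (x + z) - ball_mean s u x\<bar> \<le> G * t / sqrt (ball_vol TYPE('a) s)"
      proof (rule AE_mp[OF AE_ball_measure], rule AE_I2, rule impI)
        fix z :: 'a assume "norm z < t"
        then have "G * norm z / sqrt (ball_vol TYPE('a) s) \<le> G * t / sqrt (ball_vol TYPE('a) s)"
          using G s by (intro divide_right_mono mult_left_mono) auto
        then show "\<bar>ball_mean s u (x + z) - ball_mean s u x\<bar> \<le> G * t / sqrt (ball_vol TYPE('a) s)"
          using ball_mean_Lipschitz[OF s, of x z] by linarith
      qed
    qed (use ball_mean_commute(2)[OF t s, of x] in auto)
    finally show ?thesis .
  qed
  finally show ?thesis by (simp add: t)
qed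

text \<open>Both means are compared with the iterated mean, which does not depend on the order of the radii.\<close>

lemma ball_mean_compare:
  assumes s: "0 < s" and t: "0 < t"
  shows "\<bar>ball_mean s u x - ball_mean t u x\<bar> \<le>
    G * t / sqrt (ball_vol TYPE('a) s) + G * s / sqrt (ball_vol TYPE('a) t)"
  using ball_mean_diff_iterated[OF s t, of x] ball_mean_diff_iterated[OF t s, of x]
    ball_mean_commute(1)[OF s t, of x] by linarith

lemma ball_mean_le:
  assumes s: "0 < s" and d: "0 < d"
  shows "\<bar>ball_mean s u x\<bar> \<le> d + d powr (1 - c) * (mass / ball_vol TYPE('a) s)"
proof -
  have "ennreal \<bar>ball_mean s u x\<bar> \<le> (\<integral>\<^sup>+y. ennreal \<bar>u (x + y)\<bar> \<partial>ball_measure s)"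
    unfolding ball_mean_def using integral_norm_bound_ennreal[OF integrable_ball_measure[OF s]] by simp
  also note nn_integral_ball_measure_abs[OF s d]
  finally show ?thesis by (rule ennreal_le_iff[THEN iffD1, rotated]) (use d s mass_nonneg in simp)
qed

end

text \<open>Sum of the geometric series of dyadic steps in \<open>ball_mean_bound\<close>: the ratio
  is \<open>2 powr (1 - N / 2)\<close>, and 3 = 2 + 1 collects the two terms of
  \<open>ball_mean_compare\<close> for radii \<open>r\<close> and \<open>2 * r\<close>.\<close>

definition mean_const :: "nat \<Rightarrow> real" where
  "mean_const N = 3 / (sqrt (unit_ball_vol N) * (1 - 2 powr (1 - N / 2)))"

lemma mean_const_pos: "3 \<le> N \<Longrightarrow> 0 < mean_const N"
proof -
  assume "3 \<le> N"
  then have "2 powr (1 - N / 2) < (2::real) powr 0" by (intro powr_less_mono) auto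
  then show ?thesis by (simp add: mean_const_def)
qed

context energy_bounded
begin

text \<open>Telescoping over the radii \<open>2 ^ k * s\<close>: the steps decay geometrically, and
  \<open>ball_mean_le\<close> at the far end tends to its level \<open>d\<close>, which is also the
  slack of the estimate. The exponent \<open>1 - N / 2\<close> is that of
  \<open>r / sqrt (r ^ N)\<close>.\<close>

lemma ball_mean_bound:
  assumes N: "3 \<le> DIM('a)" and s: "0 < s"
  shows "\<bar>ball_mean s u x\<bar> \<le> mean_const DIM('a) * G * s powr (1 - DIM('a) / 2)"
proof (rule field_le_epsilon)
  fix d :: real assume d: "0 < d"
  define N where "N = DIM('a)"
  define \<omega> where "\<omega> = unit_ball_vol (real N)"
  define \<theta> :: real where "\<theta> = 2 powr (1 - N / 2)"
  define B where "B = 3 * G / sqrt \<omega> * s powr (1 - N / 2)"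
  have \<omega>: "0 < \<omega>" by (simp add: \<omega>_def)
  have "\<theta> < 2 powr 0" unfolding \<theta>_def using assms by (intro powr_less_mono) (auto simp: N_def)
  then have \<theta>: "0 < \<theta>" "\<theta> < 1" by (auto simp: \<theta>_def)
  have B: "0 \<le> B" unfolding B_def using G \<omega> by simp
  let ?a = "\<lambda>k. ball_mean (2 ^ k * s) u x"
  have vol: "r / sqrt (\<omega> * r ^ N) = r powr (1 - N / 2) / sqrt \<omega>" if "0 < r" for r
  proof -
    have "sqrt (r ^ N) = r powr (N / 2)"
      using that by (simp add: powr_half_sqrt[symmetric] powr_powr powr_realpow[symmetric])
    then show ?thesis using that by (simp add: real_sqrt_mult powr_diff)
  qed
  have step: "\<bar>?a k - ?a (Suc k)\<bar> \<le> B * \<theta> ^ k" for k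
  proof -
    let ?r = "2 ^ k * s"
    have r: "0 < ?r" using s by simp
    have le: "G * ?r / sqrt (\<omega> * (2 * ?r) ^ N) \<le> G * ?r / sqrt (\<omega> * ?r ^ N)"
      using r \<omega> G s by (intro divide_left_mono real_sqrt_le_mono mult_left_mono power_mono) auto
    have "\<bar>?a k - ?a (Suc k)\<bar> \<le> G * (2 * ?r) / sqrt (\<omega> * ?r ^ N) + G * ?r / sqrt (\<omega> * (2 * ?r) ^ N)"
      using ball_mean_compare[OF r, of "2 * ?r" x] r by (simp add: \<omega>_def N_def mult.assoc)
    also have "\<dots> \<le> 3 * G * (?r / sqrt (\<omega> * ?r ^ N))" using le by simp
    also have "\<dots> = 3 * G * (?r powr (1 - N / 2) / sqrt \<omega>)" by (simp only: vol[OF r])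
    also have "?r powr (1 - N / 2) = \<theta> ^ k * s powr (1 - N / 2)"
      using s by (simp add: powr_mult \<theta>_def powr_realpow[symmetric] powr_powr mult.commute)
    finally show ?thesis by (simp add: B_def mult_ac)
  qed
  have tele: "\<bar>?a 0 - ?a n\<bar> \<le> (\<Sum>k<n. B * \<theta> ^ k)" for n
  proof (induction n)
    case (Suc n)
    show ?case using Suc step[of n] by simp
  qed simp
  have sum: "(\<Sum>k<n. B * \<theta> ^ k) \<le> B / (1 - \<theta>)" for n
  proof -
    have "(\<Sum>k<n. \<theta> ^ k) \<le> (\<Sum>k. \<theta> ^ k)"
      using \<theta> by (intro sum_le_suminf summable_geometric) auto
    also have "\<dots> = 1 / (1 - \<theta>)" using \<theta> by (intro suminf_geometric) auto
    finally show ?thesis using B by (simp flip: sum_distrib_left) (metis mult_left_mono mult.right_neutral times_divide_eq_right)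
  qed
  have bd: "\<bar>?a 0\<bar> \<le> B / (1 - \<theta>) + (d + d powr (1 - c) * (mass / (\<omega> * (2 ^ n * s) ^ N)))" for n
    using tele[of n] sum[of n] ball_mean_le[of "2 ^ n * s" d x] s d by (simp add: \<omega>_def N_def)
  have "(\<lambda>n. B / (1 - \<theta>) + (d + d powr (1 - c) * (mass / (\<omega> * (2 ^ n * s) ^ N)))) \<longlonglongrightarrow>
      B / (1 - \<theta>) + (d + d powr (1 - c) * 0)"
  proof (intro tendsto_intros)
    have "(\<lambda>n. mass / (\<omega> * s ^ N) * ((1 / 2 ^ N) ^ n)) \<longlonglongrightarrow> mass / (\<omega> * s ^ N) * 0"
      by (intro tendsto_intros LIMSEQ_realpow_zero) (use N in \<open>auto simp: N_def\<close>)
    then show "(\<lambda>n. mass / (\<omega> * (2 ^ n * s) ^ N)) \<longlonglongrightarrow> 0"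
      by (simp add: power_mult_distrib power_divide field_simps flip: power_mult)
  qed
  then have "\<bar>?a 0\<bar> \<le> B / (1 - \<theta>) + d"
    using bd by (intro LIMSEQ_le_const) auto
  also have "B / (1 - \<theta>) = mean_const DIM('a) * G * s powr (1 - DIM('a) / 2)"
    by (simp add: mean_const_def B_def \<omega>_def \<theta>_def N_def)
  finally show "\<bar>ball_mean s u x\<bar> \<le> mean_const DIM('a) * G * s powr (1 - DIM('a) / 2) + d" by simp
qed

end

section \<open>Weak-type Sobolev inequality\<close>

lemma emeasure_ge_le_nn_integral_power2:
  assumes [measurable]: "f \<in> borel_measurable M" and d: "(0::real) < d"
    and le: "(\<integral>\<^sup>+x. ennreal ((f x)\<^sup>2) \<partial>M) \<le> ennreal b" and b: "0 \<le> b"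
  shows "emeasure M {x\<in>space M. d \<le> \<bar>f x\<bar>} \<le> ennreal (b / d\<^sup>2)"
proof -
  have "{x\<in>space M. d \<le> \<bar>f x\<bar>} = {x\<in>space M. 1 \<le> ennreal (1 / d\<^sup>2) * ennreal ((f x)\<^sup>2)}"
  proof -
    have "d \<le> \<bar>t\<bar> \<longleftrightarrow> 1 \<le> ennreal (1 / d\<^sup>2) * ennreal (t\<^sup>2)" for t
    proof -
      have "d \<le> \<bar>t\<bar> \<longleftrightarrow> d\<^sup>2 \<le> t\<^sup>2" using d by (simp add: abs_le_square_iff[symmetric])
      also have "\<dots> \<longleftrightarrow> 1 \<le> 1 / d\<^sup>2 * t\<^sup>2" using d by (simp add: field_simps)
      finally show ?thesis by (simp flip: ennreal_mult)
    qed
    then show ?thesis by blast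
  qed
  also have "emeasure M \<dots> \<le> ennreal (1 / d\<^sup>2) * (\<integral>\<^sup>+x. ennreal ((f x)\<^sup>2) * indicator (space M) x \<partial>M)"
    by (rule nn_integral_Markov_inequality) auto
  also have "(\<integral>\<^sup>+x. ennreal ((f x)\<^sup>2) * indicator (space M) x \<partial>M) = (\<integral>\<^sup>+x. ennreal ((f x)\<^sup>2) \<partial>M)"
    by (intro nn_integral_cong) auto
  also have "ennreal (1 / d\<^sup>2) * \<dots> \<le> ennreal (1 / d\<^sup>2) * ennreal b" by (intro mult_left_mono le) simp
  also have "\<dots> = ennreal (b / d\<^sup>2)" using b by (simp flip: ennreal_mult)
  finally show ?thesis .
qed

text \<open>In \<open>weak_type\<close>, the 4 comes from the halved level \<open>l / 2\<close>, and
  the power is what \<open>r\<^sup>2\<close> contributes for the chosen radius once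
  \<open>G / l\<close> is split off.\<close>

definition weak_const :: "nat \<Rightarrow> real" where
  "weak_const N = 4 * (2 * mean_const N) powr (4 / (real N - 2))"

lemma weak_const_nonneg: "0 \<le> weak_const N"
  by (simp add: weak_const_def)

text \<open>With a radius for which the mean is at most \<open>l / 2\<close>, the superlevel set
  lies where \<open>|u - A_r u|\<close> is at least \<open>l / 2\<close>, and Chebyshev's inequality
  applies.\<close>

lemma (in energy_bounded) weak_type:
  assumes N: "3 \<le> DIM('a)" and G0: "0 < G" and l: "0 < l"
  shows "emeasure lborel {x. l < \<bar>u x\<bar>} \<le>
    ennreal (weak_const DIM('a) * (G / l) powr (2 * real DIM('a) / (real DIM('a) - 2)))"
proof -
  define N where "N = real DIM('a)"
  have N3: "3 \<le> N" using assms(1) by (simp add: N_def)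
  define C where "C = mean_const DIM('a)"
  have C: "0 < C" unfolding C_def using N by (rule mean_const_pos)
  \<comment> \<open>The solution of \<open>C * G * r powr (1 - N / 2) = l / 2\<close>.\<close>
  define r where "r = (2 * C * (G / l)) powr (2 / (N - 2))"
  have r: "0 < r" using C G0 l by (simp add: r_def)
  have "r powr (1 - N / 2) = (2 * C * (G / l)) powr (2 / (N - 2) * (1 - N / 2))"
    by (simp add: r_def powr_powr)
  also have "2 / (N - 2) * (1 - N / 2) = - 1" using N3 by (simp add: field_simps)
  also have "(2 * C * (G / l)) powr - 1 = l / (2 * C * G)"
    using C G0 l by (simp add: powr_minus_divide)
  finally have "C * G * r powr (1 - N / 2) = l / 2" using C G0 by simp
  then have sm: "\<bar>ball_mean r u x\<bar> \<le> l / 2" for x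
    using ball_mean_bound[OF N r, of x] by (simp add: C_def N_def)
  have [measurable]: "ball_mean r u \<in> borel_measurable borel" using r by (rule ball_mean_measurable)
  have "emeasure lborel {x. l < \<bar>u x\<bar>} \<le> emeasure lborel {x\<in>space lborel. l / 2 \<le> \<bar>u x - ball_mean r u x\<bar>}"
    by (rule emeasure_mono) (use sm in \<open>auto simp: abs_if split: if_splits\<close>, (smt (verit) sm field_sum_of_halves)+)
  also have "\<dots> \<le> ennreal ((G * r)\<^sup>2 / (l / 2)\<^sup>2)"
    by (rule emeasure_ge_le_nn_integral_power2[OF _ _ nn_integral_diff_ball_mean[OF r]]) (use l in auto)
  also have "(G * r)\<^sup>2 / (l / 2)\<^sup>2 = 4 * r\<^sup>2 * (G / l)\<^sup>2" using l by (simp add: power2_eq_square)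
  also have "r\<^sup>2 = (2 * C * (G / l)) powr (4 / (N - 2))"
    using r by (simp add: r_def powr_powr powr_realpow[symmetric] flip: powr_numeral)
  also have "\<dots> = (2 * C) powr (4 / (N - 2)) * (G / l) powr (4 / (N - 2))"
    using C G0 l by (subst powr_mult) auto
  also have "(G / l)\<^sup>2 = (G / l) powr 2" using G0 l by simp
  also have "4 * ((2 * C) powr (4 / (N - 2)) * (G / l) powr (4 / (N - 2))) * (G / l) powr 2 =
      weak_const DIM('a) * (G / l) powr (4 / (N - 2) + 2)"
    by (simp add: weak_const_def C_def N_def powr_add)
  \<comment> \<open>The critical exponent appears: \<open>4 / (N - 2)\<close> from
    \<open>r\<^sup>2\<close> and 2 from Chebyshev.\<close>
  also have "4 / (N - 2) + 2 = 2 * N / (N - 2)" using N3 by (simp add: field_simps)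
  finally show ?thesis by (simp add: N_def)
qed

section \<open>Weak-type bounds and sums of Lebesgue spaces\<close>

lemma ennreal_suminf_ge: "f j \<le> (\<Sum>i. f i :: ennreal)"
  using sum_le_suminf[of f "{j}"] by simp

lemma dyadic_upper:
  assumes "0 < T" "T < (t::real)"
  obtains j where "2 ^ j * T < t" "t \<le> 2 ^ Suc j * T"
proof -
  obtain n where "t / T < 2 ^ n" using real_arch_pow[of 2 "t / T"] by auto
  then have ex: "\<exists>n. t \<le> 2 ^ n * T" using assms by (intro exI[of _ n]) (simp add: field_simps)
  define n where "n = (LEAST n. t \<le> 2 ^ n * T)"
  have n: "t \<le> 2 ^ n * T" unfolding n_def by (rule LeastI_ex[OF ex])
  then obtain j where j: "n = Suc j" using assms by (cases n) auto
  have "\<not> t \<le> 2 ^ j * T" using not_less_Least[of j "\<lambda>n. t \<le> 2 ^ n * T"] j by (simp add: n_def)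
  with n j show thesis by (intro that[of j]) auto
qed

lemma dyadic_lower:
  assumes "0 < t" "t \<le> (T::real)"
  obtains j where "T / 2 ^ Suc j < t" "t \<le> T / 2 ^ j"
proof -
  obtain n where "T / t < 2 ^ n" using real_arch_pow[of 2 "T / t"] by auto
  then have ex: "\<exists>n. T / 2 ^ n < t" using assms by (intro exI[of _ n]) (simp add: field_simps)
  define n where "n = (LEAST n. T / 2 ^ n < t)"
  have n: "T / 2 ^ n < t" unfolding n_def by (rule LeastI_ex[OF ex])
  then obtain j where j: "n = Suc j" using assms by (cases n) auto
  have "\<not> T / 2 ^ j < t" using not_less_Least[of j "\<lambda>n. T / 2 ^ n < t"] j by (simp add: n_def)
  with n j show thesis by (intro that[of j]) auto
qed

text \<open>A discrete layer-cake estimate: \<open>h\<close> is dominated by the sum of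
  \<open>b j\<close> over all layers \<open>l j < |w|\<close>, so the layers may overlap as long as
  they cover the set where \<open>h\<close> is nonzero. The levels may increase or decrease with
  \<open>j\<close>, which serves both tails.\<close>

lemma nn_integral_dyadic_le:
  fixes h :: "'a \<Rightarrow> ennreal" and \<theta> K a C :: real
  assumes w [measurable]: "w \<in> borel_measurable M"
    and weak: "\<And>l. 0 < l \<Longrightarrow> emeasure M {x\<in>space M. l < \<bar>w x\<bar>} \<le> ennreal (K * l powr - a)"
    and K: "0 \<le> K" and C: "0 \<le> C" and \<theta>: "0 \<le> \<theta>" "\<theta> < 1"
    and l: "\<And>j. 0 < l j" and b: "\<And>j. 0 \<le> b j"
    and geo: "\<And>j. b j * (K * l j powr - a) = C * \<theta> ^ j"
    and h: "\<And>x. x \<in> space M \<Longrightarrow> h x \<noteq> 0 \<Longrightarrow> \<exists>j. l j < \<bar>w x\<bar> \<and> h x \<le> ennreal (b j)"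
  shows "(\<integral>\<^sup>+x. h x \<partial>M) \<le> ennreal (C / (1 - \<theta>))"
proof -
  let ?A = "\<lambda>j. {x\<in>space M. l j < \<bar>w x\<bar>}"
  have "(\<integral>\<^sup>+x. h x \<partial>M) \<le> (\<integral>\<^sup>+x. (\<Sum>j. ennreal (b j) * indicator (?A j) x) \<partial>M)"
  proof (rule nn_integral_mono)
    fix x assume x: "x \<in> space M"
    show "h x \<le> (\<Sum>j. ennreal (b j) * indicator (?A j) x)"
    proof (cases "h x = 0")
      case False
      then obtain j where j: "l j < \<bar>w x\<bar>" "h x \<le> ennreal (b j)" using h[OF x] by auto
      then have "h x \<le> ennreal (b j) * indicator (?A j) x" using x by simp
      also have "\<dots> \<le> (\<Sum>j. ennreal (b j) * indicator (?A j) x)" by (rule ennreal_suminf_ge)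
      finally show ?thesis .
    qed simp
  qed
  also have "\<dots> = (\<Sum>j. \<integral>\<^sup>+x. ennreal (b j) * indicator (?A j) x \<partial>M)"
    by (rule nn_integral_suminf) simp
  also have "\<dots> = (\<Sum>j. ennreal (b j) * emeasure M (?A j))"
    by (simp add: nn_integral_cmult_indicator)
  also have "\<dots> \<le> (\<Sum>j. ennreal (C * \<theta> ^ j))"
  proof (rule suminf_le)
    fix j
    have "ennreal (b j) * emeasure M (?A j) \<le> ennreal (b j) * ennreal (K * l j powr - a)"
      by (intro mult_left_mono weak l) simp
    also have "\<dots> = ennreal (C * \<theta> ^ j)" using b K by (simp flip: ennreal_mult geo)
    finally show "ennreal (b j) * emeasure M (?A j) \<le> ennreal (C * \<theta> ^ j)" .
  qed auto
  also have "\<dots> = ennreal (\<Sum>j. C * \<theta> ^ j)"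
    using C \<theta> by (intro suminf_ennreal2 summable_mult summable_geometric) auto
  also have "(\<Sum>j. C * \<theta> ^ j) = C / (1 - \<theta>)"
    using \<theta> by (simp add: suminf_mult summable_geometric suminf_geometric)
  finally show ?thesis .
qed

text \<open>Levels \<open>2 ^ j * T\<close> go up; \<open>p < a\<close> makes the layers summable.
  The factor \<open>2 powr p\<close> is the loss from bounding \<open>|w|\<close> by the upper end
  of its layer.\<close>

lemma nn_integral_powr_upper_le:
  assumes w [measurable]: "w \<in> borel_measurable M"
    and weak: "\<And>l. 0 < l \<Longrightarrow> emeasure M {x\<in>space M. l < \<bar>w x\<bar>} \<le> ennreal (K * l powr - a)"
    and K: "0 \<le> K" and p: "0 < p" "p < a" and T: "0 < T"
  shows "(\<integral>\<^sup>+x. ennreal (\<bar>w x\<bar> powr p) * indicator {x. T < \<bar>w x\<bar>} x \<partial>M)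
    \<le> ennreal (2 powr p * K * T powr (p - a) / (1 - 2 powr (p - a)))"
proof (rule nn_integral_dyadic_le[OF w weak K])
  show "0 \<le> 2 powr p * K * T powr (p - a)" using K by simp
  have "2 powr (p - a) < (2::real) powr 0" using p by (intro powr_less_mono) auto
  then show "2 powr (p - a) < (1::real)" by simp
  show "0 < 2 ^ j * T" "0 \<le> (2 ^ Suc j * T) powr p" for j using T by auto
  show "(2 ^ Suc j * T) powr p * (K * (2 ^ j * T) powr - a) =
      2 powr p * K * T powr (p - a) * (2 powr (p - a)) ^ j" for j
  proof -
    have "(2 ^ Suc j * T) powr p = 2 powr p * (2 ^ j * T) powr p"
      using T by (simp add: powr_mult mult.assoc)
    moreover have "(2 ^ j * T) powr p * (2 ^ j * T) powr - a = (2 ^ j * T) powr (p - a)"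
      by (simp flip: powr_add)
    moreover have "(2 ^ j * T) powr (p - a) = (2 powr (p - a)) ^ j * T powr (p - a)"
      using T by (simp add: powr_mult powr_powr mult.commute flip: powr_realpow)
    ultimately show ?thesis by (simp add: mult_ac)
  qed
  fix x assume "ennreal (\<bar>w x\<bar> powr p) * indicator {x. T < \<bar>w x\<bar>} x \<noteq> 0"
  then have Tx: "T < \<bar>w x\<bar>" by (auto simp: indicator_def split: if_splits)
  obtain j where j: "2 ^ j * T < \<bar>w x\<bar>" "\<bar>w x\<bar> \<le> 2 ^ Suc j * T" by (rule dyadic_upper[OF T Tx])
  then have "\<bar>w x\<bar> powr p \<le> (2 ^ Suc j * T) powr p" using p by (intro powr_mono2) auto
  with j Tx show "\<exists>j. 2 ^ j * T < \<bar>w x\<bar> \<and>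
      ennreal (\<bar>w x\<bar> powr p) * indicator {x. T < \<bar>w x\<bar>} x \<le> ennreal ((2 ^ Suc j * T) powr p)"
    by (intro exI[of _ j]) (auto simp: ennreal_leI)
qed auto

text \<open>Levels go down to 0; \<open>a < q\<close> makes the layers summable. The factor
  \<open>2 powr a\<close> is the loss in the weak-type bound, taken at the lower end
  \<open>T / 2 ^ Suc j\<close>.\<close>

lemma nn_integral_powr_lower_le:
  assumes w [measurable]: "w \<in> borel_measurable M"
    and weak: "\<And>l. 0 < l \<Longrightarrow> emeasure M {x\<in>space M. l < \<bar>w x\<bar>} \<le> ennreal (K * l powr - a)"
    and K: "0 \<le> K" and q: "0 < a" "a < q" and T: "0 < T"
  shows "(\<integral>\<^sup>+x. ennreal (\<bar>w x\<bar> powr q) * indicator {x. \<bar>w x\<bar> \<le> T} x \<partial>M)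
    \<le> ennreal (2 powr a * K * T powr (q - a) / (1 - 2 powr (a - q)))"
proof (rule nn_integral_dyadic_le[OF w weak K])
  show "0 \<le> 2 powr a * K * T powr (q - a)" using K by simp
  have "2 powr (a - q) < (2::real) powr 0" using q by (intro powr_less_mono) auto
  then show "2 powr (a - q) < (1::real)" by simp
  show "0 < T / 2 ^ Suc j" "0 \<le> (T / 2 ^ j) powr q" for j using T by auto
  show "(T / 2 ^ j) powr q * (K * (T / 2 ^ Suc j) powr - a) =
      2 powr a * K * T powr (q - a) * (2 powr (a - q)) ^ j" for j
  proof -
    have "(T / 2 ^ Suc j) powr - a = 2 powr a * (T / 2 ^ j) powr - a"
      using T by (simp add: powr_mult powr_divide powr_minus_divide field_simps)
    moreover have "(T / 2 ^ j) powr q * (T / 2 ^ j) powr - a = (T / 2 ^ j) powr (q - a)"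
      by (simp flip: powr_add)
    moreover have "(T / 2 ^ j) powr (q - a) = T powr (q - a) * (2 powr (a - q)) ^ j"
    proof -
      have "(T / 2 ^ j) powr (q - a) = T powr (q - a) / (2 ^ j) powr (q - a)"
        using T by (simp add: powr_divide)
      also have "(2 ^ j) powr (q - a) = (2 powr (q - a)) ^ j"
        by (simp add: powr_powr mult.commute flip: powr_realpow)
      also have "T powr (q - a) / (2 powr (q - a)) ^ j = T powr (q - a) * (2 powr - (q - a)) ^ j"
        by (simp only: powr_minus divide_inverse power_inverse)
      finally show ?thesis by simp
    qed
    ultimately show ?thesis by (simp add: mult_ac)
  qed
  fix x assume "ennreal (\<bar>w x\<bar> powr q) * indicator {x. \<bar>w x\<bar> \<le> T} x \<noteq> 0"
  then have Tx: "\<bar>w x\<bar> \<le> T" "0 < \<bar>w x\<bar>" by (auto simp: indicator_def split: if_splits)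
  obtain j where j: "T / 2 ^ Suc j < \<bar>w x\<bar>" "\<bar>w x\<bar> \<le> T / 2 ^ j" by (rule dyadic_lower[OF Tx(2,1)])
  then have "\<bar>w x\<bar> powr q \<le> (T / 2 ^ j) powr q" using q by (intro powr_mono2) auto
  with j Tx show "\<exists>j. T / 2 ^ Suc j < \<bar>w x\<bar> \<and>
      ennreal (\<bar>w x\<bar> powr q) * indicator {x. \<bar>w x\<bar> \<le> T} x \<le> ennreal ((T / 2 ^ j) powr q)"
    by (intro exI[of _ j]) (auto simp: ennreal_leI)
qed auto

section \<open>Splitting at a level in \<open>L^p + L^q\<close>\<close>

lemma Lp_sum_norm_le:
  assumes "(v1, v2) \<in> Lp_decomp p q v"
  shows "Lp_sum_norm p q v \<le> Lp_norm p v1 + Lp_norm q v2"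
proof -
  have "Lp_sum_norm p q v \<le> (case (v1, v2) of (v1, v2) \<Rightarrow> Lp_norm p v1 + Lp_norm q v2)"
    unfolding Lp_sum_norm_def
    by (rule cINF_lower[OF _ assms]) (auto intro!: bdd_belowI2[of _ 0] simp: Lp_norm_def)
  then show ?thesis by simp
qed

lemma Lp_sum_norm_nonneg:
  assumes "v \<in> Lp_sum p q"
  shows "0 \<le> Lp_sum_norm p q v"
  unfolding Lp_sum_norm_def
  by (rule cINF_greatest) (use assms in \<open>auto simp: Lp_sum_def Lp_norm_def\<close>)

lemma Lp_of_nn_integral:
  fixes f :: "real^'n \<Rightarrow> real"
  assumes [measurable]: "f \<in> borel_measurable borel"
    and le: "(\<integral>\<^sup>+x. ennreal (\<bar>f x\<bar> powr p) \<partial>lborel) \<le> ennreal A" and A: "0 \<le> A" and p: "0 < p"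
  shows "f \<in> Lp p" and "Lp_norm p f \<le> A powr (1 / p)"
proof -
  have m: "f \<in> borel_measurable lebesgue" by (rule measurable_completion) simp
  have int: "integrable lborel (\<lambda>x. \<bar>f x\<bar> powr p)"
  proof (rule integrableI_bounded)
    show "(\<integral>\<^sup>+x. ennreal (norm (\<bar>f x\<bar> powr p)) \<partial>lborel) < \<infinity>"
      using le by (simp add: order.strict_trans1)
  qed simp
  then show "f \<in> Lp p" using m by (simp add: Lp_def integrable_completion)
  have "ennreal (LINT x|lborel. \<bar>f x\<bar> powr p) \<le> ennreal A"
    using le nn_integral_eq_integral[OF int] by simp
  then have "(LINT x|lebesgue. \<bar>f x\<bar> powr p) \<le> A"
    using A by (simp add: integral_completion)
  then show "Lp_norm p f \<le> A powr (1 / p)"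
    unfolding Lp_norm_def using p by (intro powr_mono2) auto
qed

text \<open>Large values go to \<open>L^p\<close>, small ones to \<open>L^q\<close>. The splitting
  is done on a Borel representative \<open>w\<close>, where integrals over \<open>lborel\<close> are
  available; \<open>v\<close> is only Lebesgue measurable.\<close>

lemma Lp_sum_truncation:
  fixes v w :: "real^'n \<Rightarrow> real"
  assumes v: "v \<in> borel_measurable lebesgue" and w [measurable]: "w \<in> borel_measurable borel"
    and vw: "AE x in lborel. v x = w x"
    and up: "(\<integral>\<^sup>+x. ennreal (\<bar>w x\<bar> powr p) * indicator {x. T < \<bar>w x\<bar>} x \<partial>lborel) \<le> ennreal A"
    and low: "(\<integral>\<^sup>+x. ennreal (\<bar>w x\<bar> powr q) * indicator {x. \<bar>w x\<bar> \<le> T} x \<partial>lborel) \<le> ennreal B"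
    and AB: "0 \<le> A" "0 \<le> B" and pq: "0 < p" "0 < q"
  shows "v \<in> Lp_sum p q" and "Lp_sum_norm p q v \<le> A powr (1 / p) + B powr (1 / q)"
proof -
  let ?w1 = "\<lambda>x. w x * indicator {x. T < \<bar>w x\<bar>} x" and ?w2 = "\<lambda>x. w x * indicator {x. \<bar>w x\<bar> \<le> T} x"
  have 1: "(\<integral>\<^sup>+x. ennreal (\<bar>?w1 x\<bar> powr p) \<partial>lborel) \<le> ennreal A"
    by (rule order_trans[OF nn_integral_mono up]) (auto simp: indicator_def)
  have 2: "(\<integral>\<^sup>+x. ennreal (\<bar>?w2 x\<bar> powr q) \<partial>lborel) \<le> ennreal B"
    by (rule order_trans[OF nn_integral_mono low]) (auto simp: indicator_def)
  have "AE x in lebesgue. v x = ?w1 x + ?w2 x"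
    using AE_completion[OF vw] by eventually_elim (auto simp: indicator_def)
  then have dec: "(?w1, ?w2) \<in> Lp_decomp p q v"
    using Lp_of_nn_integral(1)[OF _ 1] Lp_of_nn_integral(1)[OF _ 2] AB pq by (simp add: Lp_decomp_def)
  then show "v \<in> Lp_sum p q" using v by (auto simp: Lp_sum_def)
  show "Lp_sum_norm p q v \<le> A powr (1 / p) + B powr (1 / q)"
    using Lp_sum_norm_le[OF dec] Lp_of_nn_integral(2)[OF _ 1] Lp_of_nn_integral(2)[OF _ 2] AB pq by simp
qed

text \<open>The common constant of the two tail estimates: \<open>s = p\<close>,
  \<open>d = a - p\<close> above the level and \<open>s = a\<close>, \<open>d = q - a\<close> below
  it.\<close>

definition layer_const :: "real \<Rightarrow> real \<Rightarrow> real" where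
  "layer_const s d = 2 powr s / (1 - 2 powr - d)"

lemma layer_const_nonneg: "0 < d \<Longrightarrow> 0 \<le> layer_const s d"
proof -
  assume "0 < d"
  then have "2 powr - d < (2::real) powr 0" by (intro powr_less_mono) auto
  then show ?thesis by (simp add: layer_const_def)
qed

text \<open>The splitting level is \<open>G\<close> itself: then
  \<open>G powr a * G powr (p - a) = G powr p\<close>, likewise for \<open>q\<close>, and the norm
  bound becomes linear in \<open>G\<close>.\<close>

lemma
  fixes v w :: "real^'n \<Rightarrow> real"
  assumes v: "v \<in> borel_measurable lebesgue" and w [measurable]: "w \<in> borel_measurable borel"
    and vw: "AE x in lborel. v x = w x" and K: "0 \<le> K" and G: "0 < G"
    and weak: "\<And>l. 0 < l \<Longrightarrow> emeasure lborel {x. l < \<bar>w x\<bar>} \<le> ennreal (K * (G / l) powr a)"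
    and pq: "0 < p" "p < a" "a < q"
  shows Lp_sum_weak: "v \<in> Lp_sum p q"
    and Lp_sum_norm_weak_le: "Lp_sum_norm p q v \<le>
      ((K * layer_const p (a - p)) powr (1 / p) + (K * layer_const a (q - a)) powr (1 / q)) * G"
proof -
  have weak': "emeasure lborel {x \<in> space lborel. l < \<bar>w x\<bar>} \<le> ennreal (K * G powr a * l powr - a)" if "0 < l" for l
    using weak[OF that] G that by (simp add: powr_divide powr_minus_divide)
  have nn: "0 \<le> layer_const p (a - p)" "0 \<le> layer_const a (q - a)"
    using pq by (auto intro: layer_const_nonneg)
  have up: "(\<integral>\<^sup>+x. ennreal (\<bar>w x\<bar> powr p) * indicator {x. G < \<bar>w x\<bar>} x \<partial>lborel) \<le> ennreal (K * layer_const p (a - p) * G powr p)"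
    using nn_integral_powr_upper_le[OF _ weak' _ pq(1,2) G] K G
    by (simp add: layer_const_def powr_diff mult_ac)
  have low: "(\<integral>\<^sup>+x. ennreal (\<bar>w x\<bar> powr q) * indicator {x. \<bar>w x\<bar> \<le> G} x \<partial>lborel) \<le> ennreal (K * layer_const a (q - a) * G powr q)"
    using nn_integral_powr_lower_le[OF _ weak' _ _ pq(3) G] K G pq
    by (simp add: layer_const_def powr_diff mult_ac)
  note tr = Lp_sum_truncation[OF v w vw up low]
  show "v \<in> Lp_sum p q" using tr(1) nn K pq by simp
  have "Lp_sum_norm p q v \<le> (K * layer_const p (a - p) * G powr p) powr (1 / p) + (K * layer_const a (q - a) * G powr q) powr (1 / q)"
    using tr(2) nn K pq by simp
  also have "\<dots> = ((K * layer_const p (a - p)) powr (1 / p) + (K * layer_const a (q - a)) powr (1 / q)) * G"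
    using nn K pq G by (simp add: powr_mult powr_powr distrib_right)
  finally show "Lp_sum_norm p q v \<le> ((K * layer_const p (a - p)) powr (1 / p) + (K * layer_const a (q - a)) powr (1 / q)) * G" .
qed

text \<open>Two levels divide the values. Below \<open>T\<close> the \<open>L^q\<close> part and
  above \<open>R\<close> the \<open>L^p\<close> part are small uniformly in \<open>n\<close> by the
  weak-type bound; in between, \<open>R powr p\<close> multiplies a measure that tends to 0.\<close>

lemma Lp_sum_norm_tendsto_weak:
  fixes v w :: "nat \<Rightarrow> real^'n \<Rightarrow> real"
  assumes v: "\<And>n. v n \<in> borel_measurable lebesgue" and w [measurable]: "\<And>n. w n \<in> borel_measurable borel"
    and vw: "\<And>n. AE x in lborel. v n x = w n x" and K: "0 \<le> K"
    and weak: "\<And>n l. 0 < l \<Longrightarrow> emeasure lborel {x. l < \<bar>w n x\<bar>} \<le> ennreal (K * l powr - a)"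
    and conv: "\<And>d. 0 < d \<Longrightarrow> (\<lambda>n. emeasure lborel {x. d < \<bar>w n x\<bar>}) \<longlonglongrightarrow> 0"
    and pq: "0 < p" "p < a" "a < q"
  shows "(\<lambda>n. Lp_sum_norm p q (v n)) \<longlonglongrightarrow> 0"
proof (rule LIMSEQ_I)
  fix e :: real assume e: "0 < e"
  have weak': "emeasure lborel {x \<in> space lborel. l < \<bar>w n x\<bar>} \<le> ennreal (K * l powr - a)" if "0 < l" for l n
    using weak[OF that] by simp
  define C1 where "C1 = K * layer_const p (a - p)"
  define C2 where "C2 = K * layer_const a (q - a)"
  have C: "0 \<le> C1" "0 \<le> C2" using K pq by (simp_all add: C1_def C2_def layer_const_nonneg)
  \<comment> \<open>The \<open>L^q\<close> part gets norm \<open>e / 3\<close>; the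
    \<open>L^p\<close> part gets \<open>\<eta>\<close> twice, again \<open>e / 3\<close> in norm.
    Adding 1 to \<open>C1\<close> and \<open>C2\<close> avoids division by 0; as
    \<open>p - a\<close> is negative, \<open>R\<close> grows as \<open>\<eta>\<close>
    shrinks.\<close>
  define \<eta> where "\<eta> = (e / 3) powr p / 2"
  define T where "T = ((e / 3) powr q / (C2 + 1)) powr (1 / (q - a))"
  define R where "R = (\<eta> / (C1 + 1)) powr (1 / (p - a))"
  have pos: "0 < \<eta>" "0 < T" "0 < R" using e C by (auto simp: \<eta>_def T_def R_def)
  have "C2 * T powr (q - a) = (e / 3) powr q * (C2 / (C2 + 1))" using C e pq by (simp add: T_def powr_powr)
  also have "\<dots> \<le> (e / 3) powr q" using C by (intro mult_left_le) auto
  finally have C2T: "C2 * T powr (q - a) \<le> (e / 3) powr q" .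
  have "C1 * R powr (p - a) = \<eta> * (C1 / (C1 + 1))" using C e pq pos by (simp add: R_def powr_powr)
  also have "\<dots> \<le> \<eta>" using C pos by (intro mult_left_le) auto
  finally have C1R: "C1 * R powr (p - a) \<le> \<eta>" .
  have "eventually (\<lambda>n. emeasure lborel {x. T < \<bar>w n x\<bar>} < ennreal (\<eta> / R powr p)) sequentially"
    using conv[OF pos(2)] pos by (intro order_tendstoD) auto
  then obtain n0 where n0: "\<And>n. n0 \<le> n \<Longrightarrow> emeasure lborel {x. T < \<bar>w n x\<bar>} < ennreal (\<eta> / R powr p)"
    unfolding eventually_sequentially by blast
  show "\<exists>n0. \<forall>n\<ge>n0. norm (Lp_sum_norm p q (v n) - 0) < e"
  proof (intro exI allI impI)
    fix n assume n: "n0 \<le> n"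
    have low: "(\<integral>\<^sup>+x. ennreal (\<bar>w n x\<bar> powr q) * indicator {x. \<bar>w n x\<bar> \<le> T} x \<partial>lborel) \<le> ennreal ((e / 3) powr q)"
    proof -
      have "(\<integral>\<^sup>+x. ennreal (\<bar>w n x\<bar> powr q) * indicator {x. \<bar>w n x\<bar> \<le> T} x \<partial>lborel) \<le> ennreal (C2 * T powr (q - a))"
        using nn_integral_powr_lower_le[OF _ weak' K _ pq(3) pos(2), of n] pq
        by (simp add: C2_def layer_const_def mult_ac)
      also have "\<dots> \<le> ennreal ((e / 3) powr q)" by (rule ennreal_leI[OF C2T])
      finally show ?thesis .
    qed
    \<comment> \<open>The pointwise split below holds whichever of \<open>T\<close> and
      \<open>R\<close> is larger: where \<open>|w n x|\<close> exceeds \<open>T\<close> but not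
      \<open>R\<close>, its power is at most \<open>R powr p\<close>.\<close>
    have up: "(\<integral>\<^sup>+x. ennreal (\<bar>w n x\<bar> powr p) * indicator {x. T < \<bar>w n x\<bar>} x \<partial>lborel) \<le> ennreal ((e / 3) powr p)"
    proof -
      have "(\<integral>\<^sup>+x. ennreal (\<bar>w n x\<bar> powr p) * indicator {x. T < \<bar>w n x\<bar>} x \<partial>lborel) \<le>
          (\<integral>\<^sup>+x. ennreal (\<bar>w n x\<bar> powr p) * indicator {x. R < \<bar>w n x\<bar>} x +
            ennreal (R powr p) * indicator {x. T < \<bar>w n x\<bar>} x \<partial>lborel)"
        using pq by (intro nn_integral_mono) (auto simp: indicator_def intro!: ennreal_leI powr_mono2)
      also have "\<dots> = (\<integral>\<^sup>+x. ennreal (\<bar>w n x\<bar> powr p) * indicator {x. R < \<bar>w n x\<bar>} x \<partial>lborel) +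
            ennreal (R powr p) * emeasure lborel {x. T < \<bar>w n x\<bar>}"
        by (subst nn_integral_add) (auto simp: nn_integral_cmult_indicator)
      also have "(\<integral>\<^sup>+x. ennreal (\<bar>w n x\<bar> powr p) * indicator {x. R < \<bar>w n x\<bar>} x \<partial>lborel) \<le> ennreal (C1 * R powr (p - a))"
        using nn_integral_powr_upper_le[OF _ weak' K pq(1,2) pos(3), of n]
        by (simp add: C1_def layer_const_def mult_ac)
      also have "\<dots> \<le> ennreal \<eta>" by (rule ennreal_leI[OF C1R])
      also have "ennreal (R powr p) * emeasure lborel {x. T < \<bar>w n x\<bar>} \<le> ennreal (R powr p) * ennreal (\<eta> / R powr p)"
        by (intro mult_left_mono less_imp_le[OF n0[OF n]]) simp
      also have "\<dots> = ennreal \<eta>" using pos by (simp flip: ennreal_mult)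
      also have "ennreal \<eta> + ennreal \<eta> = ennreal ((e / 3) powr p)"
        using pos by (simp add: \<eta>_def flip: ennreal_plus)
      finally show ?thesis by (simp add: add_mono)
    qed
    note tr = Lp_sum_truncation[OF v w vw up low]
    have "v n \<in> Lp_sum p q" using tr(1) pq by simp
    moreover have "Lp_sum_norm p q (v n) \<le> ((e / 3) powr p) powr (1 / p) + ((e / 3) powr q) powr (1 / q)"
      using tr(2) pq by simp
    ultimately show "norm (Lp_sum_norm p q (v n) - 0) < e"
      using e pq Lp_sum_norm_nonneg[of "v n" p q] by (simp add: powr_powr)
  qed
qed

section \<open>Convergence in measure\<close>

lemma tendsto_0_ennrealI:
  fixes f :: "'b \<Rightarrow> ennreal"
  assumes "\<And>e. 0 < e \<Longrightarrow> eventually (\<lambda>n. f n \<le> ennreal e) F"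
  shows "(f \<longlongrightarrow> 0) F"
proof (rule order_tendstoI)
  fix a :: ennreal assume "0 < a"
  then obtain e where e: "0 < ennreal e" "ennreal e < a"
    by (metis dense ennreal_cases less_top order_less_le_trans top_greatest less_imp_neq)
  then have "0 < e" by simp
  from assms[OF this] show "eventually (\<lambda>n. f n < a) F"
    by eventually_elim (use e in auto)
qed simp

text \<open>The condition \<open>l < |t|\<close> is open: if the limit satisfies it, the sequence
  eventually does, and Fatou's lemma for indicators applies.\<close>

lemma emeasure_superlevel_AE_limit:
  fixes f :: "nat \<Rightarrow> 'a \<Rightarrow> real"
  assumes [measurable]: "\<And>n. f n \<in> borel_measurable M" "g \<in> borel_measurable M"
    and lim: "AE x in M. (\<lambda>n. f n x) \<longlonglongrightarrow> g x"
    and le: "eventually (\<lambda>n. emeasure M {x\<in>space M. l < \<bar>f n x\<bar>} \<le> b) sequentially"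
  shows "emeasure M {x\<in>space M. l < \<bar>g x\<bar>} \<le> b"
proof -
  let ?i = "\<lambda>f x. indicator {x\<in>space M. l < \<bar>f x\<bar>} x :: ennreal"
  have "emeasure M {x\<in>space M. l < \<bar>g x\<bar>} = (\<integral>\<^sup>+x. ?i g x \<partial>M)" by simp
  also have "\<dots> \<le> (\<integral>\<^sup>+x. liminf (\<lambda>n. ?i (f n) x) \<partial>M)"
  proof (rule nn_integral_mono_AE)
    show "AE x in M. ?i g x \<le> liminf (\<lambda>n. ?i (f n) x)"
      using lim
    proof eventually_elim
      fix x assume lim: "(\<lambda>n. f n x) \<longlonglongrightarrow> g x"
      show "?i g x \<le> liminf (\<lambda>n. ?i (f n) x)"
      proof (cases "x \<in> space M \<and> l < \<bar>g x\<bar>")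
        case True
        have "(\<lambda>n. \<bar>f n x\<bar>) \<longlonglongrightarrow> \<bar>g x\<bar>" using lim by (rule tendsto_rabs)
        then have "eventually (\<lambda>n. l < \<bar>f n x\<bar>) sequentially" using True by (auto dest: order_tendstoD)
        then have "eventually (\<lambda>n. 1 \<le> ?i (f n) x) sequentially" by eventually_elim (use True in simp)
        then have "1 \<le> liminf (\<lambda>n. ?i (f n) x)" by (rule Liminf_bounded)
        then show ?thesis using True by simp
      qed auto
    qed
  qed
  also have "\<dots> \<le> liminf (\<lambda>n. \<integral>\<^sup>+x. ?i (f n) x \<partial>M)" by (rule nn_integral_liminf) simp
  also have "\<dots> = liminf (\<lambda>n. emeasure M {x\<in>space M. l < \<bar>f n x\<bar>})" by simp
  also have "\<dots> \<le> limsup (\<lambda>n. emeasure M {x\<in>space M. l < \<bar>f n x\<bar>})"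
    by (rule Liminf_le_Limsup) simp
  also have "\<dots> \<le> b" by (rule Limsup_bounded[OF le])
  finally show ?thesis .
qed

text \<open>Riesz's argument: a rapidly Cauchy subsequence converges almost everywhere by
  Borel-Cantelli. That subsequence is returned as well, since bounds for the limit are derived from
  it.\<close>

lemma Cauchy_in_measure_limit:
  fixes u :: "nat \<Rightarrow> 'a \<Rightarrow> real"
  assumes [measurable]: "\<And>n. u n \<in> borel_measurable M"
    and Cauchy: "\<And>d e. 0 < d \<Longrightarrow> 0 < e \<Longrightarrow>
      \<exists>n0. \<forall>m\<ge>n0. \<forall>n\<ge>n0. emeasure M {x\<in>space M. d < \<bar>u m x - u n x\<bar>} \<le> ennreal e"
  obtains v r where "v \<in> borel_measurable M" "strict_mono (r :: nat \<Rightarrow> nat)"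
    "AE x in M. (\<lambda>j. u (r j) x) \<longlonglongrightarrow> v x"
    "\<And>d. 0 < d \<Longrightarrow> (\<lambda>n. emeasure M {x\<in>space M. d < \<bar>u n x - v x\<bar>}) \<longlonglongrightarrow> 0"
proof -
  have "\<forall>j. \<exists>n0. \<forall>m\<ge>n0. \<forall>n\<ge>n0. emeasure M {x\<in>space M. (1/2)^j < \<bar>u m x - u n x\<bar>} \<le> ennreal ((1/2)^j)"
    using Cauchy by simp
  then obtain g where g: "\<And>j m n. g j \<le> m \<Longrightarrow> g j \<le> n \<Longrightarrow>
      emeasure M {x\<in>space M. (1/2)^j < \<bar>u m x - u n x\<bar>} \<le> ennreal ((1/2)^j)"
    by metis
  \<comment> \<open>The sum dominates all thresholds up to \<open>j\<close>, and \<open>+ j\<close>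
    makes \<open>r\<close> strictly increasing.\<close>
  define r where "r j = (\<Sum>i\<le>j. g i) + j" for j
  have r: "strict_mono r" by (rule strict_monoI_Suc) (simp add: r_def)
  have gr: "g j \<le> r j" for j using member_le_sum[of j "{..j}" g] by (simp add: r_def)
  have gr': "g j \<le> r (Suc j)" for j using gr[of j] r by (meson le_trans less_imp_le lessI strict_mono_def)
  define A where "A j = {x\<in>space M. (1/2)^j < \<bar>u (r (Suc j)) x - u (r j) x\<bar>}" for j
  have A_le: "emeasure M (A j) \<le> ennreal ((1/2)^j)" for j unfolding A_def by (rule g[OF gr' gr])
  have "AE x in M. eventually (\<lambda>j. x \<in> space M - A j) sequentially"
  proof (rule borel_cantelli_AE1)
    show "A j \<in> sets M" for j unfolding A_def by measurable
    show "emeasure M (A j) < \<infinity>" for j using A_le[of j] by (simp add: order.strict_trans1)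
    show "summable (\<lambda>j. measure M (A j))"
    proof (rule summable_comparison_test')
      show "summable (\<lambda>j. (1/2::real)^j)" by (rule summable_geometric) simp
      show "norm (measure M (A j)) \<le> (1/2)^j" if "0 \<le> j" for j
        using A_le[of j] by (simp add: measure_def enn2real_leI)
    qed
  qed
  then have conv: "AE x in M. convergent (\<lambda>j. u (r j) x)"
  proof eventually_elim
    fix x assume "eventually (\<lambda>j. x \<in> space M - A j) sequentially"
    then obtain j0 where j0: "\<And>j. j0 \<le> j \<Longrightarrow> x \<in> space M \<and> x \<notin> A j" by (auto simp: eventually_sequentially)
    have "summable (\<lambda>j. u (r (Suc j)) x - u (r j) x)"
    proof (rule summable_comparison_test')
      show "summable (\<lambda>j. (1/2::real)^j)" by (rule summable_geometric) simp
      show "norm (u (r (Suc j)) x - u (r j) x) \<le> (1/2)^j" if "j0 \<le> j" for j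
        using j0[OF that] by (auto simp: A_def not_less)
    qed
    then have "convergent (\<lambda>n. \<Sum>j<n. u (r (Suc j)) x - u (r j) x)" by (simp add: summable_iff_convergent)
    then have "convergent (\<lambda>n. u (r n) x - u (r 0) x)" by (simp only: sum_lessThan_telescope[of "\<lambda>j. u (r j) x"])
    from convergent_add[OF this convergent_const[of "u (r 0) x"]] show "convergent (\<lambda>j. u (r j) x)" by simp
  qed
  define v where "v x = lim (\<lambda>j. u (r j) x)" for x
  have v [measurable]: "v \<in> borel_measurable M" unfolding v_def[abs_def] by (rule borel_measurable_lim_metric) simp
  have lim: "AE x in M. (\<lambda>j. u (r j) x) \<longlonglongrightarrow> v x"
    using conv by eventually_elim (simp add: v_def convergent_LIMSEQ_iff)
  have "(\<lambda>n. emeasure M {x\<in>space M. d < \<bar>u n x - v x\<bar>}) \<longlonglongrightarrow> 0" if d: "0 < d" for d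
  proof (rule tendsto_0_ennrealI)
    fix e :: real assume "0 < e"
    from Cauchy[OF d this] obtain n0 where n0: "\<And>m n. n0 \<le> m \<Longrightarrow> n0 \<le> n \<Longrightarrow>
        emeasure M {x\<in>space M. d < \<bar>u m x - u n x\<bar>} \<le> ennreal e" by blast
    \<comment> \<open>With \<open>n\<close> fixed, the Cauchy bound passes to the limit along
      \<open>r\<close>, so the whole sequence converges in measure.\<close>
    have "emeasure M {x\<in>space M. d < \<bar>u n x - v x\<bar>} \<le> ennreal e" if n: "n0 \<le> n" for n
    proof (rule emeasure_superlevel_AE_limit[where f = "\<lambda>j x. u n x - u (r j) x"])
      show "AE x in M. (\<lambda>j. u n x - u (r j) x) \<longlonglongrightarrow> u n x - v x"
        using lim by eventually_elim (intro tendsto_intros)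
      show "eventually (\<lambda>j. emeasure M {x\<in>space M. d < \<bar>u n x - u (r j) x\<bar>} \<le> ennreal e) sequentially"
        using n seq_suble[OF r] by (intro eventually_sequentiallyI[of n0] n0) (auto intro: order_trans)
    qed auto
    then show "eventually (\<lambda>n. emeasure M {x\<in>space M. d < \<bar>u n x - v x\<bar>} \<le> ennreal e) sequentially"
      by (rule eventually_sequentiallyI)
  qed
  with v r lim show thesis by (intro that)
qed

section \<open>Invariance of Lebesgue measure under orthogonal maps\<close>

lemma measurable_orthogonal_transformation:
  fixes T :: "'a::euclidean_space \<Rightarrow> 'a"
  assumes "orthogonal_transformation T"
  shows "T \<in> borel_measurable borel"
proof (rule borel_measurable_continuous_onI, rule linear_continuous_on)
  show "bounded_linear T"
    using orthogonal_transformation_linear[OF assms] by (simp add: linear_conv_bounded_linear)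
qed

text \<open>
  With \<open>B\<close> the unit ball, the double integral of \<open>1\<^sub>E(T x) 1\<^sub>B(y - T x)\<close> is evaluated in both orders; the
  substitution \<open>x \<mapsto> T\<^sup>-\<^sup>1 y - x\<close> exchanges the roles of \<open>E\<close> and \<open>B\<close>. The invariance results for orthogonal maps
  in the library require a well-ordered index type.
\<close>

lemma distr_orthogonal_transformation_lborel:
  fixes T :: "'a::euclidean_space \<Rightarrow> 'a"
  assumes T: "orthogonal_transformation T"
  shows "distr lborel borel T = lborel"
proof (rule measure_eqI)
  fix E assume "E \<in> sets (distr lborel borel T)"
  then have [measurable]: "E \<in> sets borel" by simp
  have lin: "linear T" using T by (rule orthogonal_transformation_linear)
  note [measurable] = measurable_orthogonal_transformation[OF T]
  have ind [measurable]: "(\<lambda>x. indicator S (T x) :: ennreal) \<in> borel_measurable borel"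
    if [measurable]: "S \<in> sets borel" for S
    by measurable
  have ind2 [measurable]: "(\<lambda>x. indicator S (y - T x) :: ennreal) \<in> borel_measurable borel"
    if [measurable]: "S \<in> sets borel" for S y
    by measurable
  define B where "B = ball (0::'a) 1"
  have [measurable]: "B \<in> sets borel" by (simp add: B_def)
  have invol: "(\<integral>\<^sup>+x. g x \<partial>lborel) = (\<integral>\<^sup>+x. g (a - x) \<partial>lborel)"
    if [measurable]: "g \<in> borel_measurable borel" for a and g :: "'a \<Rightarrow> ennreal"
  proof -
    have "(\<integral>\<^sup>+x. g x \<partial>lborel) =
        (\<integral>\<^sup>+x. g x \<partial>density (distr lborel borel (\<lambda>x. a + (- 1) *\<^sub>R x)) (\<lambda>_. ennreal (\<bar>- 1 :: real\<bar> ^ DIM('a))))"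
      by (subst lborel_affine[of "- 1" a, symmetric]) auto
    also have "\<dots> = (\<integral>\<^sup>+x. g (a + (- 1) *\<^sub>R x) \<partial>lborel)"
      by (subst nn_integral_density) (auto simp: nn_integral_distr)
    finally show ?thesis by simp
  qed
  have shift: "(\<integral>\<^sup>+x. indicator S (x - a) \<partial>lborel) = emeasure lborel S"
    if [measurable]: "S \<in> sets borel" for a and S :: "'a set"
  proof -
    have "emeasure lborel S = (\<integral>\<^sup>+x. indicator S x \<partial>distr lborel borel ((+) (- a)))" by (simp add: lborel_distr_plus)
    also have "\<dots> = (\<integral>\<^sup>+x. indicator S (- a + x) \<partial>lborel)" by (rule nn_integral_distr) auto
    finally show ?thesis by simp
  qed
  \<comment> \<open>Norm preservation enters here: the ball is a test set known to be invariant, and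
    comparing \<open>E\<close> with it determines the scaling factor.\<close>
  have TB: "indicator B (T x) = (indicator B x :: ennreal)" for x
    using T by (simp add: B_def indicator_def orthogonal_transformation_norm)
  let ?\<mu> = "emeasure lborel"
  have "?\<mu> B * emeasure (distr lborel borel T) E = (\<integral>\<^sup>+x. indicator E (T x) * ?\<mu> B \<partial>lborel)"
  proof -
    have "emeasure (distr lborel borel T) E = (\<integral>\<^sup>+x. indicator E x \<partial>distr lborel borel T)" by simp
    also have "\<dots> = (\<integral>\<^sup>+x. indicator E (T x) \<partial>lborel)" by (rule nn_integral_distr) auto
    finally show ?thesis by (subst nn_integral_multc) (auto simp: mult.commute)
  qed
  also have "\<dots> = (\<integral>\<^sup>+x. (\<integral>\<^sup>+y. indicator E (T x) * indicator B (y - T x) \<partial>lborel) \<partial>lborel)"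
    by (intro nn_integral_cong, subst nn_integral_cmult) (auto simp: shift)
  also have "\<dots> = (\<integral>\<^sup>+y. (\<integral>\<^sup>+x. indicator E (T x) * indicator B (y - T x) \<partial>lborel) \<partial>lborel)"
    by (rule lborel_pair.Fubini') simp
  also have "\<dots> = (\<integral>\<^sup>+y. (\<integral>\<^sup>+x. indicator E (y - T x) * indicator B x \<partial>lborel) \<partial>lborel)"
  proof (rule nn_integral_cong)
    fix y
    obtain a where a: "T a = y" using orthogonal_transformation_surj[OF T] by (metis surjD)
    have "(\<integral>\<^sup>+x. indicator E (T x) * indicator B (y - T x) \<partial>lborel) =
        (\<integral>\<^sup>+x. indicator E (T (a - x)) * indicator B (y - T (a - x)) \<partial>lborel)"
      by (rule invol) simp
    also have "\<dots> = (\<integral>\<^sup>+x. indicator E (y - T x) * indicator B x \<partial>lborel)"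
      by (simp add: linear_diff[OF lin] a TB del: indicator_simps)
    finally show "(\<integral>\<^sup>+x. indicator E (T x) * indicator B (y - T x) \<partial>lborel) =
      (\<integral>\<^sup>+x. indicator E (y - T x) * indicator B x \<partial>lborel)" .
  qed
  also have "\<dots> = (\<integral>\<^sup>+x. (\<integral>\<^sup>+y. indicator E (y - T x) * indicator B x \<partial>lborel) \<partial>lborel)"
    by (rule lborel_pair.Fubini') simp
  also have "\<dots> = ?\<mu> B * ?\<mu> E"
    by (simp add: nn_integral_multc shift nn_integral_cmult mult.commute)
  finally have "?\<mu> B * emeasure (distr lborel borel T) E = ?\<mu> B * ?\<mu> E" .
  moreover have "?\<mu> B \<noteq> 0" "?\<mu> B \<noteq> \<top>" by (auto simp: B_def emeasure_ball ennreal_eq_0_iff not_le)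
  ultimately show "emeasure (distr lborel borel T) E = ?\<mu> E"
    by (simp add: ennreal_mult_cancel_left)
qed simp

section \<open>Reflections and block-radial functions\<close>

text \<open>The Householder reflection in the hyperplane orthogonal to \<open>v\<close>; for
  \<open>v = 0\<close> it is the identity, which covers the case \<open>x = y\<close> in
  \<open>reflect_along_diff\<close>.\<close>

definition reflect_along :: "'a::real_inner \<Rightarrow> 'a \<Rightarrow> 'a" where
  "reflect_along v z = z - (2 * (v \<bullet> z) / (v \<bullet> v)) *\<^sub>R v"

lemma orthogonal_transformation_reflect_along: "orthogonal_transformation (reflect_along v)"
proof -
  have "norm (reflect_along v z) = norm z" for z
  proof (cases "v = 0")
    case False
    define a where "a = 2 * (v \<bullet> z) / (v \<bullet> v)"
    have a: "a * (v \<bullet> v) = 2 * (v \<bullet> z)" using False by (simp add: a_def)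
    have "reflect_along v z \<bullet> reflect_along v z = z \<bullet> z - 2 * a * (v \<bullet> z) + a * (a * (v \<bullet> v))"
      by (simp add: reflect_along_def a_def[symmetric] inner_diff_left inner_diff_right inner_commute)
    also have "\<dots> = z \<bullet> z" by (simp add: a)
    finally show ?thesis by (simp add: norm_eq_sqrt_inner)
  qed (simp add: reflect_along_def)
  moreover have "linear (reflect_along v)"
    by (rule linearI)
      (simp_all add: reflect_along_def inner_add_right distrib_left add_divide_distrib scaleR_add_left scaleR_diff_right)
  ultimately show ?thesis by (simp add: orthogonal_transformation)
qed

text \<open>Equal norms give \<open>2 * ((x - y) \<bullet> x) = (x - y) \<bullet> (x - y)\<close>,
  so the coefficient is 1. This supplies an explicit orthogonal map between any two points of a
  sphere.\<close>

lemma reflect_along_diff: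
  assumes "norm x = norm y"
  shows "reflect_along (x - y) x = y"
proof (cases "x = y")
  case False
  have "x \<bullet> x = y \<bullet> y" using assms by (simp add: norm_eq_sqrt_inner)
  then have "2 * ((x - y) \<bullet> x) = (x - y) \<bullet> (x - y)" by (simp add: inner_diff inner_commute)
  moreover have "(x - y) \<bullet> (x - y) \<noteq> 0" using False by simp
  ultimately show ?thesis by (simp add: reflect_along_def)
qed (simp add: reflect_along_def)

lemma block_norm_cong:
  fixes y z :: "real^'n"
  assumes "norm y = norm z" "\<And>j. b j \<noteq> i \<Longrightarrow> y $ j = z $ j"
  shows "block_norm b i y = block_norm b i z"
proof -
  have split: "(norm x)\<^sup>2 = (\<Sum>j | b j = i. (x $ j)\<^sup>2) + (\<Sum>j | b j \<noteq> i. (x $ j)\<^sup>2)" for x :: "real^'n"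
  proof -
    have "(norm x)\<^sup>2 = (\<Sum>j\<in>UNIV. (x $ j)\<^sup>2)"
      by (simp add: norm_vec_def L2_set_def sum_nonneg)
    also have "\<dots> = (\<Sum>j\<in>{j. b j = i} \<union> {j. b j \<noteq> i}. (x $ j)\<^sup>2)" by (rule sum.cong) auto
    also have "\<dots> = (\<Sum>j | b j = i. (x $ j)\<^sup>2) + (\<Sum>j | b j \<noteq> i. (x $ j)\<^sup>2)"
      by (rule sum.union_disjoint) auto
    finally show ?thesis .
  qed
  have "(\<Sum>j | b j \<noteq> i. (y $ j)\<^sup>2) = (\<Sum>j | b j \<noteq> i. (z $ j)\<^sup>2)" using assms(2) by (intro sum.cong) auto
  then have "(\<Sum>j | b j = i. (y $ j)\<^sup>2) = (\<Sum>j | b j = i. (z $ j)\<^sup>2)" using split[of y] split[of z] assms(1) by simp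
  then show ?thesis by (simp add: block_norm_def L2_set_def)
qed

text \<open>A reflection along a vector supported in block \<open>i\<close> fixes all other
  coordinates and, being norm preserving, keeps the norm of block \<open>i\<close>. Pointwise
  radiality thus becomes invariance under measure-preserving maps.\<close>

lemma block_radial_reflect_along:
  fixes v z :: "real^'n"
  assumes w: "block_radial m b w" and i: "i \<in> {1..m}" and v: "\<And>j. b j \<noteq> i \<Longrightarrow> v $ j = 0"
  shows "w (reflect_along v z) = w z"
proof -
  have off: "reflect_along v z $ j = z $ j" if "b j \<noteq> i" for j
    using v[OF that] by (simp add: reflect_along_def)
  have "block_norm b i (reflect_along v z) = block_norm b i z"
    by (rule block_norm_cong[OF orthogonal_transformation_norm[OF orthogonal_transformation_reflect_along] off])
  then have "w (with_block b i (reflect_along v z) z) = w (with_block b i z z)"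
    using w i unfolding block_radial_def by blast
  moreover have "with_block b i (reflect_along v z) z = reflect_along v z" "with_block b i z z = z"
    using off by (auto simp: with_block_def vec_eq_iff)
  ultimately show ?thesis by simp
qed

text \<open>The points for \<open>l < k\<close> lie on a circle in the directions of two coordinates
  of one block, which is where blocks of dimension at least 2 are used. Equal spacing in coordinate
  \<open>j1\<close> alone already separates them.\<close>

lemma block_sphere_points:
  fixes x :: "real^'n"
  assumes b: "b j1 = i" "b j2 = i" "j1 \<noteq> j2" and d: "0 \<le> d" and far: "real k * d \<le> \<bar>x $ j1\<bar>"
  obtains y :: "nat \<Rightarrow> real^'n"
  where "\<And>l. l < k \<Longrightarrow> norm (y l) = norm x"
    and "\<And>l j. b j \<noteq> i \<Longrightarrow> y l $ j = x $ j"
    and "\<And>l l'. l \<noteq> l' \<Longrightarrow> d \<le> dist (y l) (y l')"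
proof -
  define R where "R = (x $ j1)\<^sup>2 + (x $ j2)\<^sup>2"
  \<comment> \<open>Coordinate \<open>j2\<close> restores the sum of squares \<open>R\<close>; the
    radicand is nonnegative for \<open>l < k\<close> because \<open>l * d\<close> is then at most
    \<open>|x $ j1|\<close>.\<close>
  define y :: "nat \<Rightarrow> real^'n" where
    "y l = (\<chi> j. if j = j1 then l * d else if j = j2 then sqrt (R - (l * d)\<^sup>2) else x $ j)" for l
  have nrm: "(norm z)\<^sup>2 = (z $ j1)\<^sup>2 + ((z $ j2)\<^sup>2 + (\<Sum>j\<in>UNIV - {j1} - {j2}. (z $ j)\<^sup>2))" for z :: "real^'n"
  proof -
    have "(norm z)\<^sup>2 = (\<Sum>j\<in>UNIV. (z $ j)\<^sup>2)"
      by (simp add: norm_vec_def L2_set_def sum_nonneg)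
    also have "\<dots> = (z $ j1)\<^sup>2 + (\<Sum>j\<in>UNIV - {j1}. (z $ j)\<^sup>2)" by (rule sum.remove) auto
    also have "(\<Sum>j\<in>UNIV - {j1}. (z $ j)\<^sup>2) = (z $ j2)\<^sup>2 + (\<Sum>j\<in>UNIV - {j1} - {j2}. (z $ j)\<^sup>2)"
      using b by (intro sum.remove) auto
    finally show ?thesis .
  qed
  have "norm (y l) = norm x" if l: "l < k" for l
  proof -
    have "l * d \<le> k * d" using l d by (intro mult_right_mono) auto
    then have "l * d \<le> \<bar>x $ j1\<bar>" using far by simp
    then have "(l * d)\<^sup>2 \<le> \<bar>x $ j1\<bar>\<^sup>2" using d by (intro power_mono) auto
    then have "(l * d)\<^sup>2 \<le> R" unfolding R_def by (simp add: add_increasing2)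
    then have "(norm (y l))\<^sup>2 = (norm x)\<^sup>2"
      unfolding nrm using b by (simp add: y_def R_def)
    then show ?thesis by simp
  qed
  moreover have "y l $ j = x $ j" if "b j \<noteq> i" for l j
    using that b by (auto simp: y_def)
  moreover have "d \<le> dist (y l) (y l')" if "l \<noteq> l'" for l l'
  proof -
    have "1 \<le> \<bar>real l - real l'\<bar>" using that by linarith
    then have "d \<le> \<bar>real l - real l'\<bar> * d" using d mult_right_mono[of 1 "\<bar>real l - real l'\<bar>" d] by simp
    also have "\<dots> = \<bar>(y l - y l') $ j1\<bar>" using d by (simp add: y_def abs_mult left_diff_distrib[symmetric])
    also have "\<dots> \<le> norm (y l - y l')" by (rule component_le_norm_cart)
    finally show ?thesis by (simp add: dist_norm)
  qed
  ultimately show thesis by (rule that)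
qed

section \<open>Decay of ball means at infinity\<close>

lemma abs_le_add_square: "\<bar>t\<bar> \<le> d + t\<^sup>2 / d" if "0 < d" for t d :: real
proof (cases "\<bar>t\<bar> \<le> d")
  case False
  then have "d * \<bar>t\<bar> \<le> \<bar>t\<bar> * \<bar>t\<bar>" by (intro mult_right_mono) auto
  then have "\<bar>t\<bar> \<le> t\<^sup>2 / d" using that by (simp add: field_simps power2_eq_square)
  then show ?thesis using that by simp
qed (use that in \<open>auto intro: add_increasing2\<close>)

text \<open>All \<open>k\<close> copies of the ball about \<open>x\<close> carry the same integral
  of \<open>|u|\<close>. Write \<open>u\<close> as \<open>A_r u\<close> plus an error: the first
  part is uniformly small for large \<open>r\<close>, while the error, split at the level
  \<open>d\<close>, has square integral at most \<open>(G * r)\<^sup>2\<close> over all copies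
  together, so its share per copy carries a factor \<open>1 / k\<close>.\<close>

lemma (in energy_bounded) ball_mean_orbit_bound:
  fixes k :: nat and s r d :: real and y :: "nat \<Rightarrow> 'a" and T :: "nat \<Rightarrow> 'a \<Rightarrow> 'a"
  assumes N: "3 \<le> DIM('a)" and s: "0 < s" and r: "0 < r" and d: "0 < d" and k: "0 < k"
    and T: "\<And>i. i < k \<Longrightarrow> orthogonal_transformation (T i)" "\<And>i. i < k \<Longrightarrow> T i x = y i"
    and inv: "\<And>i. i < k \<Longrightarrow> AE z in lborel. u (T i z) = u z"
    and sep: "\<And>i j. i < k \<Longrightarrow> j < k \<Longrightarrow> i \<noteq> j \<Longrightarrow> 2 * s \<le> dist (y i) (y j)"
  shows "\<bar>ball_mean s u x\<bar> \<le>
    mean_const DIM('a) * G * r powr (1 - DIM('a) / 2) + d + (G * r)\<^sup>2 / (d * k * ball_vol TYPE('a) s)"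
proof -
  define m where "m = mean_const DIM('a) * G * r powr (1 - DIM('a) / 2)"
  have m: "0 \<le> m" unfolding m_def using mean_const_pos[OF N] G by simp
  define V where "V = ball_vol TYPE('a) s"
  have V: "0 < V" unfolding V_def using s by (rule ball_vol_pos)
  define B where "B i = ball (y i) s" for i
  define Bx where "Bx = ball x s"
  have [measurable]: "B i \<in> sets borel" "Bx \<in> sets borel" for i by (auto simp: B_def Bx_def)
  define J where "J = (\<integral>\<^sup>+z. ennreal \<bar>u z\<bar> * indicator Bx z \<partial>lborel)"
  let ?D = "\<lambda>z. u z - ball_mean r u z"
  have [measurable]: "ball_mean r u \<in> borel_measurable borel" using r by (rule ball_mean_measurable)
  have J: "J = (\<integral>\<^sup>+z. ennreal \<bar>u z\<bar> * indicator (B i) z \<partial>lborel)" if i: "i < k" for i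
  proof -
    have lin: "linear (T i)" using T(1)[OF i] by (rule orthogonal_transformation_linear)
    note [measurable] = measurable_orthogonal_transformation[OF T(1)[OF i]]
    have "(\<integral>\<^sup>+z. ennreal \<bar>u z\<bar> * indicator (B i) z \<partial>lborel) =
        (\<integral>\<^sup>+z. ennreal \<bar>u z\<bar> * indicator (B i) z \<partial>distr lborel borel (T i))"
      by (simp add: distr_orthogonal_transformation_lborel[OF T(1)[OF i]])
    also have "\<dots> = (\<integral>\<^sup>+z. ennreal \<bar>u (T i z)\<bar> * indicator (B i) (T i z) \<partial>lborel)"
      by (rule nn_integral_distr) auto
    also have "\<dots> = J"
      unfolding J_def
    proof (rule nn_integral_cong_AE)
      show "AE z in lborel. ennreal \<bar>u (T i z)\<bar> * indicator (B i) (T i z) = ennreal \<bar>u z\<bar> * indicator Bx z"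
        using inv[OF i]
      proof eventually_elim
        fix z assume "u (T i z) = u z"
        moreover have "dist (y i) (T i z) = dist x z"
          by (simp add: dist_norm flip: T(2)[OF i] linear_diff[OF lin])
            (simp add: orthogonal_transformation_norm[OF T(1)[OF i]])
        ultimately show "ennreal \<bar>u (T i z)\<bar> * indicator (B i) (T i z) = ennreal \<bar>u z\<bar> * indicator Bx z"
          by (simp add: indicator_def B_def Bx_def)
      qed
    qed
    finally show ?thesis ..
  qed
  have pt: "\<bar>u z\<bar> \<le> (m + d) + (?D z)\<^sup>2 / d" for z
    using ball_mean_bound[OF N r, of z] abs_le_add_square[OF d, of "?D z"] by (simp add: m_def)
  \<comment> \<open>Open balls of radius \<open>s\<close> with centres at least \<open>2 * s\<close>
    apart are disjoint, so the error term is counted only once on the whole space.\<close>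
  have one: "(\<Sum>i<k. indicator (B i) z) \<le> (1 :: ennreal)" for z
  proof (cases "\<exists>i<k. z \<in> B i")
    case True
    then obtain i where i: "i < k" "z \<in> B i" by auto
    have "z \<notin> B j" if "j < k" "j \<noteq> i" for j
      using sep[of i j] that i dist_triangle2[of "y i" "y j" z] by (auto simp: B_def)
    then have "(\<Sum>j<k. indicator (B j) z) = (\<Sum>j<k. if j = i then 1 else 0 :: ennreal)"
      using i by (intro sum.cong) (auto simp: indicator_def)
    then show ?thesis using i by simp
  qed auto
  have "ennreal k * J = (\<Sum>i<k. \<integral>\<^sup>+z. ennreal \<bar>u z\<bar> * indicator (B i) z \<partial>lborel)"
    by (simp add: J[symmetric] ennreal_of_nat_eq_real_of_nat)
  also have "\<dots> = (\<integral>\<^sup>+z. (\<Sum>i<k. ennreal \<bar>u z\<bar> * indicator (B i) z) \<partial>lborel)"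
    by (rule nn_integral_sum[symmetric]) simp
  also have "\<dots> \<le> (\<integral>\<^sup>+z. (\<Sum>i<k. ennreal (m + d) * indicator (B i) z) + ennreal (1 / d) * ennreal ((?D z)\<^sup>2) \<partial>lborel)"
  proof (rule nn_integral_mono)
    fix z
    have "(\<Sum>i<k. ennreal \<bar>u z\<bar> * indicator (B i) z) \<le>
        (\<Sum>i<k. (ennreal (m + d) + ennreal ((?D z)\<^sup>2 / d)) * indicator (B i) z)"
      using pt[of z] d m by (intro sum_mono mult_right_mono) (auto simp flip: ennreal_plus intro: ennreal_leI)
    also have "\<dots> = (\<Sum>i<k. ennreal (m + d) * indicator (B i) z) +
        ennreal ((?D z)\<^sup>2 / d) * (\<Sum>i<k. indicator (B i) z)"
      by (simp add: distrib_right sum.distrib sum_distrib_left)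
    also have "ennreal ((?D z)\<^sup>2 / d) * (\<Sum>i<k. indicator (B i) z) \<le> ennreal ((?D z)\<^sup>2 / d) * 1"
      by (intro mult_left_mono one) simp
    also have "\<dots> = ennreal (1 / d) * ennreal ((?D z)\<^sup>2)" using d by (simp flip: ennreal_mult)
    finally show "(\<Sum>i<k. ennreal \<bar>u z\<bar> * indicator (B i) z) \<le>
        (\<Sum>i<k. ennreal (m + d) * indicator (B i) z) + ennreal (1 / d) * ennreal ((?D z)\<^sup>2)"
      by (simp add: add_left_mono)
  qed
  also have "\<dots> = (\<Sum>i<k. ennreal (m + d) * emeasure lborel (B i)) + ennreal (1 / d) * (\<integral>\<^sup>+z. ennreal ((?D z)\<^sup>2) \<partial>lborel)"
  proof (subst nn_integral_add)
    show "(\<integral>\<^sup>+z. (\<Sum>i<k. ennreal (m + d) * indicator (B i) z) \<partial>lborel) +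
        (\<integral>\<^sup>+z. ennreal (1 / d) * ennreal ((?D z)\<^sup>2) \<partial>lborel) =
      (\<Sum>i<k. ennreal (m + d) * emeasure lborel (B i)) + ennreal (1 / d) * (\<integral>\<^sup>+z. ennreal ((?D z)\<^sup>2) \<partial>lborel)"
      by (subst nn_integral_sum) (simp_all add: nn_integral_cmult_indicator nn_integral_cmult del: sum_mult_indicator)
  qed simp_all
  also have "\<dots> \<le> (\<Sum>i<k. ennreal (m + d) * ennreal V) + ennreal (1 / d) * ennreal ((G * r)\<^sup>2)"
    using s by (intro add_mono sum_mono mult_left_mono nn_integral_diff_ball_mean r)
      (auto simp: emeasure_ball V_def B_def)
  also have "\<dots> = ennreal (k * ((m + d) * V + (G * r)\<^sup>2 / (d * k)))"
    using m d V k by (simp add: ennreal_of_nat_eq_real_of_nat distrib_left flip: ennreal_mult ennreal_plus)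
  also have "\<dots> = ennreal k * ennreal ((m + d) * V + (G * r)\<^sup>2 / (d * k))"
    using m d V by (subst ennreal_mult) auto
  finally have Jle: "J \<le> ennreal ((m + d) * V + (G * r)\<^sup>2 / (d * k))"
    using k by (simp add: ennreal_mult_le_mult_iff)
  have "ennreal \<bar>ball_mean s u x\<bar> \<le> (\<integral>\<^sup>+z. ennreal \<bar>u (x + z)\<bar> \<partial>ball_measure s)"
    unfolding ball_mean_def using integral_norm_bound_ennreal[OF integrable_ball_measure[OF s]] by simp
  also have "\<dots> = (\<integral>\<^sup>+z. ennreal \<bar>u (x + z)\<bar> * indicator Bx (x + z) \<partial>lborel) / ennreal V"
    unfolding V_def by (subst nn_integral_ball_measure[OF _ s]) (auto simp: indicator_def dist_norm Bx_def)
  also have "\<dots> = J / ennreal V"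
    unfolding J_def using nn_integral_lborel_shift[of "\<lambda>z. ennreal \<bar>u z\<bar> * indicator Bx z" x] by simp
  also have "\<dots> \<le> ennreal ((m + d) * V + (G * r)\<^sup>2 / (d * k)) / ennreal V"
    by (rule divide_right_mono_ennreal[OF Jle])
  also have "\<dots> = ennreal (((m + d) * V + (G * r)\<^sup>2 / (d * k)) / V)"
    by (rule divide_ennreal) (use m d V in auto)
  also have "((m + d) * V + (G * r)\<^sup>2 / (d * k)) / V = m + d + (G * r)\<^sup>2 / (d * k * V)"
    using V by (simp add: add_divide_distrib)
  finally have "\<bar>ball_mean s u x\<bar> \<le> m + d + (G * r)\<^sup>2 / (d * k * V)"
    by (rule ennreal_le_iff[THEN iffD1, rotated]) (use m d V in simp)
  then show ?thesis by (simp add: m_def V_def)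
qed

text \<open>Meant for Borel representatives, which agree with a radial function only up to a null
  set.\<close>

definition AE_block_radial :: "nat \<Rightarrow> ('n::finite \<Rightarrow> nat) \<Rightarrow> (real^'n \<Rightarrow> real) \<Rightarrow> bool" where
  "AE_block_radial m b u \<longleftrightarrow> (\<exists>w. (AE x in lborel. w x = u x) \<and> block_radial m b w)"

lemma AE_orthogonal_transformation:
  fixes T :: "'a::euclidean_space \<Rightarrow> 'a"
  assumes T: "orthogonal_transformation T" and P: "AE x in lborel. P x"
  shows "AE x in lborel. P (T x)"
proof -
  note [measurable] = measurable_orthogonal_transformation[OF T]
  have "AE x in distr lborel borel T. P x"
    unfolding distr_orthogonal_transformation_lborel[OF T] by (rule P)
  then show ?thesis by (rule AE_distrD[rotated]) simp
qed

text \<open>One \<open>R\<close> serves all functions with the same bound \<open>G\<close>: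
  \<open>r\<close> is fixed first to make the mean term small, then the number \<open>k\<close> of
  copies. Far from the origin some coordinate is large enough to leave room for \<open>k\<close>
  separated points in its block.\<close>

lemma ball_mean_block_radial_decay:
  fixes b :: "'n::finite \<Rightarrow> nat"
  assumes N: "3 \<le> CARD('n)" and s: "0 < s" and e: "0 < e" and G: "0 \<le> G"
    and blocks: "\<And>j. b j \<in> {1..m}" "\<And>j. \<exists>j'. j' \<noteq> j \<and> b j' = b j"
  obtains R where "\<And>u x. energy_bounded c G u \<Longrightarrow> AE_block_radial m b u \<Longrightarrow> R \<le> norm x \<Longrightarrow>
    \<bar>ball_mean s u (x::real^'n)\<bar> \<le> e"
proof -
  let ?n = "real CARD('n)"
  define V where "V = ball_vol TYPE(real^'n) s"
  have V: "0 < V" unfolding V_def using s by (rule ball_vol_pos)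
  define C where "C = mean_const CARD('n) * G"
  have C: "0 \<le> C" unfolding C_def using mean_const_pos[OF N] G by simp
  have "((\<lambda>r. C * r powr (1 - ?n / 2)) \<longlongrightarrow> C * 0) at_top"
    by (intro tendsto_intros tendsto_neg_powr filterlim_ident) (use N in auto)
  then have "eventually (\<lambda>r. C * r powr (1 - ?n / 2) < e / 3) at_top"
    by (rule order_tendstoD(2)) (use e in simp)
  from eventually_happens'[OF trivial_limit_at_top_linorder eventually_conj[OF eventually_gt_at_top[of 0] this]]
  obtain r where r: "0 < r" "C * r powr (1 - ?n / 2) < e / 3" by blast
  \<comment> \<open>\<open>k\<close> absorbs the factor \<open>(G * r)\<^sup>2\<close> in the third
    term of \<open>ball_mean_orbit_bound\<close>, used with \<open>d = e / 3\<close>.\<close>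
  obtain k where k: "(G * r)\<^sup>2 / (e / 3 * V) / (e / 3) < real k" using reals_Archimedean2 by blast
  moreover have "0 \<le> (G * r)\<^sup>2 / (e / 3 * V) / (e / 3)" using e V by simp
  ultimately have k0: "0 < k" by linarith
  have ke: "(G * r)\<^sup>2 / (e / 3 * k * V) \<le> e / 3"
    using k k0 e V by (simp add: field_simps)
  have "\<bar>ball_mean s u x\<bar> \<le> e"
    if u: "energy_bounded c G u" and rad: "AE_block_radial m b u" and x: "?n * (k * (2 * s)) \<le> norm x" for u and x :: "real^'n"
  proof -
    interpret energy_bounded c G u by (rule u)
    have "\<exists>j. k * (2 * s) \<le> \<bar>x $ j\<bar>"
    proof (rule ccontr)
      assume "\<not> ?thesis"
      then have "(\<Sum>j\<in>UNIV. \<bar>x $ j\<bar>) < (\<Sum>j\<in>(UNIV :: 'n set). k * (2 * s))"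
        by (intro sum_strict_mono) (auto simp: not_le)
      then show False using norm_le_l1_cart[of x] x by simp
    qed
    then obtain j1 where j1: "k * (2 * s) \<le> \<bar>x $ j1\<bar>" by auto
    obtain j2 where j2: "j1 \<noteq> j2" "b j2 = b j1" using blocks(2)[of j1] by metis
    from s have s2: "0 \<le> 2 * s" by simp
    obtain y :: "nat \<Rightarrow> real^'n" where
      y: "\<And>l. l < k \<Longrightarrow> norm (y l) = norm x" "\<And>l j. b j \<noteq> b j1 \<Longrightarrow> y l $ j = x $ j"
        "\<And>l l'. l \<noteq> l' \<Longrightarrow> 2 * s \<le> dist (y l) (y l')"
      using block_sphere_points[OF refl j2(2,1) s2 j1] by metis
    obtain w where w: "AE x in lborel. w x = u x" "block_radial m b w" using rad by (auto simp: AE_block_radial_def)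
    \<comment> \<open>\<open>x - y l\<close> vanishes outside the block of \<open>j1\<close>, so
      this reflection leaves a block-radial function invariant.\<close>
    let ?T = "\<lambda>l. reflect_along (x - y l)"
    have "\<bar>ball_mean s u x\<bar> \<le> mean_const DIM(real^'n) * G * r powr (1 - DIM(real^'n) / 2) + e / 3 +
        (G * r)\<^sup>2 / (e / 3 * k * ball_vol TYPE(real^'n) s)"
    proof (rule ball_mean_orbit_bound[where T = ?T and y = y])
      show "AE z in lborel. u (?T l z) = u z" if l: "l < k" for l
        using w(1) AE_orthogonal_transformation[OF orthogonal_transformation_reflect_along w(1), of "x - y l"]
      proof eventually_elim
        fix z assume "w z = u z" "w (?T l z) = u (?T l z)"
        then show "u (?T l z) = u z"
          using block_radial_reflect_along[OF w(2) blocks(1), of j1 "x - y l" z] y(2) by simp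
      qed
    qed (use N s r e k0 y in \<open>auto simp: orthogonal_transformation_reflect_along reflect_along_diff\<close>)
    then show ?thesis using r ke by (simp add: C_def V_def)
  qed
  then show thesis by (rule that)
qed

section \<open>Continuously differentiable functions with compact support\<close>

text \<open>The regularity that the gradient estimates use; closure under differences is checked for
  this class, which contains \<open>C0_infty\<close>.\<close>

definition C1_compact :: "(real^'n \<Rightarrow> real) set" where
  "C1_compact = {f. (\<forall>x. f differentiable (at x)) \<and> continuous_on UNIV (grad f) \<and>
     compact (closure {x. f x \<noteq> 0})}"

lemma C0_infty_C1_compact: "f \<in> C0_infty \<Longrightarrow> f \<in> C1_compact"
proof -
  assume f: "f \<in> C0_infty"
  then have "C_k (Suc 0) f" by (simp only: C0_infty_def mem_Collect_eq)
  then show ?thesis using f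
    unfolding C1_compact_def C0_infty_def grad_def[abs_def]
    by (auto intro: continuous_on_vec_lambda)
qed

lemma has_derivative_grad:
  fixes f :: "real^'n \<Rightarrow> real"
  assumes "f differentiable (at x)"
  shows "(f has_derivative (\<lambda>h. grad f x \<bullet> h)) (at x)"
proof -
  let ?D = "frechet_derivative f (at x)"
  have lin: "linear ?D" using assms by (rule linear_frechet_derivative)
  have "?D h = grad f x \<bullet> h" for h
  proof -
    have "?D h = ?D (\<Sum>i\<in>UNIV. h $ i *\<^sub>R axis i 1)"
      using basis_expansion[of h] by (simp add: scalar_mult_eq_scaleR)
    also have "\<dots> = (\<Sum>i\<in>UNIV. h $ i * ?D (axis i 1))"
      by (simp add: linear_sum[OF lin] linear_cmul[OF lin])
    finally show ?thesis by (simp add: grad_def inner_vec_def mult.commute)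
  qed
  then have "?D = (\<lambda>h. grad f x \<bullet> h)" by (rule ext)
  then show ?thesis using assms frechet_derivative_works by metis
qed

lemma grad_eqI:
  fixes f :: "real^'n \<Rightarrow> real"
  assumes "(f has_derivative (\<lambda>h. g \<bullet> h)) (at x)"
  shows "grad f x = g"
proof -
  have "frechet_derivative f (at x) = (\<lambda>h. g \<bullet> h)" using frechet_derivative_at[OF assms] ..
  then show ?thesis by (simp add: grad_def vec_eq_iff inner_axis)
qed

lemma C1_compact_diff:
  assumes f: "f \<in> C1_compact" and g: "g \<in> C1_compact"
  shows "(\<lambda>x. f x - g x) \<in> C1_compact" and "grad (\<lambda>x. f x - g x) = (\<lambda>x. grad f x - grad g x)"
proof -
  have df: "f differentiable (at x)" "g differentiable (at x)" for x using f g by (auto simp: C1_compact_def)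
  show eq: "grad (\<lambda>x. f x - g x) = (\<lambda>x. grad f x - grad g x)"
  proof (rule ext, rule grad_eqI)
    fix x
    show "((\<lambda>x. f x - g x) has_derivative (\<lambda>h. (grad f x - grad g x) \<bullet> h)) (at x)"
      unfolding inner_diff_left by (intro has_derivative_diff has_derivative_grad df)
  qed
  have "compact (closure {x. f x - g x \<noteq> 0})"
  proof -
    have "bounded ({x. f x \<noteq> 0} \<union> {x. g x \<noteq> 0})"
      using f g by (auto simp: C1_compact_def compact_closure)
    then show ?thesis unfolding compact_closure by (rule bounded_subset) auto
  qed
  moreover have "continuous_on UNIV (grad (\<lambda>x. f x - g x))"
    using f g unfolding eq by (auto simp: C1_compact_def intro: continuous_on_diff)
  ultimately show "(\<lambda>x. f x - g x) \<in> C1_compact"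
    using df unfolding C1_compact_def by (auto intro: differentiable_diff)
qed

lemma C1_compact_continuous: "f \<in> C1_compact \<Longrightarrow> continuous_on UNIV f"
  unfolding C1_compact_def by (auto intro!: differentiable_imp_continuous_on simp: differentiable_on_def)

lemma C1_compact_measurable:
  assumes "f \<in> C1_compact"
  shows "f \<in> borel_measurable borel" "grad f \<in> borel_measurable borel"
  using C1_compact_continuous[OF assms] assms
  by (auto simp: C1_compact_def intro: borel_measurable_continuous_onI)

lemma grad_eq_0_outside:
  assumes f: "f \<in> C1_compact" and x: "x \<notin> closure {x. f x \<noteq> 0}"
  shows "grad f x = 0"
proof (rule grad_eqI)
  have "((\<lambda>_. 0) has_derivative (\<lambda>h. 0 \<bullet> h)) (at x)" by simp
  then show "(f has_derivative (\<lambda>h. 0 \<bullet> h)) (at x)"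
  proof (rule has_derivative_transform_within_open)
    show "open (- closure {x. f x \<noteq> 0})" by auto
    show "0 = f z" if "z \<in> - closure {x. f x \<noteq> 0}" for z
      using that closure_subset[of "{x. f x \<noteq> 0}"] by auto
  qed (use x in simp)
qed

text \<open>The Bochner integral in \<open>grad_norm\<close> is genuine here: the integrand is
  continuous and vanishes off a compact set, so no default value intervenes.\<close>

lemma nn_integral_grad:
  fixes f :: "real^'n \<Rightarrow> real"
  assumes f: "f \<in> C1_compact"
  shows "(\<integral>\<^sup>+x. ennreal ((norm (grad f x))\<^sup>2) \<partial>lborel) = ennreal ((grad_norm f)\<^sup>2)"
proof -
  let ?K = "closure {x. f x \<noteq> 0}"
  have K: "compact ?K" and cont: "continuous_on UNIV (grad f)" using f by (auto simp: C1_compact_def)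
  note [measurable] = C1_compact_measurable[OF f]
  have "integrable lborel (\<lambda>x. indicator ?K x *\<^sub>R (norm (grad f x))\<^sup>2)"
    by (rule borel_integrable_compact[OF K])
      (intro continuous_intros continuous_on_subset[OF cont] subset_UNIV)
  also have "(\<lambda>x. indicator ?K x *\<^sub>R (norm (grad f x))\<^sup>2) = (\<lambda>x. (norm (grad f x))\<^sup>2)"
    using grad_eq_0_outside[OF f] by (auto simp: fun_eq_iff indicator_def)
  finally have int: "integrable lborel (\<lambda>x. (norm (grad f x))\<^sup>2)" .
  have "(grad_norm f)\<^sup>2 = (LINT x|lborel. (norm (grad f x))\<^sup>2)"
    unfolding grad_norm_def by (subst real_sqrt_pow2) (auto simp: integral_completion)
  then show ?thesis by (simp add: nn_integral_eq_integral[OF int])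
qed

lemma grad_norm_nonneg: "0 \<le> grad_norm f"
  by (simp add: grad_norm_def)

lemma grad_norm_leI:
  assumes f: "f \<in> C1_compact" and a: "0 \<le> a"
    and le: "(\<integral>\<^sup>+x. ennreal ((norm (grad f x))\<^sup>2) \<partial>lborel) \<le> ennreal (a\<^sup>2)"
  shows "grad_norm f \<le> a"
proof -
  have "(grad_norm f)\<^sup>2 \<le> a\<^sup>2" using le unfolding nn_integral_grad[OF f] by simp
  then show ?thesis using a by (rule power2_le_imp_le)
qed

text \<open>Minkowski's inequality in \<open>L^2\<close>, with Cauchy-Schwarz for the cross
  term.\<close>

lemma nn_integral_power2_add_le:
  fixes f g :: "'a \<Rightarrow> real"
  assumes [measurable]: "f \<in> borel_measurable M" "g \<in> borel_measurable M"
    and f: "(\<integral>\<^sup>+x. ennreal ((f x)\<^sup>2) \<partial>M) \<le> ennreal (a\<^sup>2)" and g: "(\<integral>\<^sup>+x. ennreal ((g x)\<^sup>2) \<partial>M) \<le> ennreal (b\<^sup>2)"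
    and ab: "0 \<le> a" "0 \<le> b"
  shows "(\<integral>\<^sup>+x. ennreal ((f x + g x)\<^sup>2) \<partial>M) \<le> ennreal ((a + b)\<^sup>2)"
proof -
  have "(\<integral>\<^sup>+x. ennreal \<bar>f x\<bar> * ennreal \<bar>g x\<bar> \<partial>M)\<^sup>2 \<le>
      (\<integral>\<^sup>+x. (ennreal \<bar>f x\<bar>)\<^sup>2 \<partial>M) * (\<integral>\<^sup>+x. (ennreal \<bar>g x\<bar>)\<^sup>2 \<partial>M)"
    by (rule Cauchy_Schwarz_nn_integral) auto
  also have "\<dots> \<le> ennreal (a\<^sup>2) * ennreal (b\<^sup>2)"
    using f g by (intro mult_mono) (simp_all add: ennreal_power)
  also have "\<dots> = (ennreal (a * b))\<^sup>2" using ab by (simp add: ennreal_power power_mult_distrib flip: ennreal_mult)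
  finally have fg: "(\<integral>\<^sup>+x. ennreal \<bar>f x\<bar> * ennreal \<bar>g x\<bar> \<partial>M) \<le> ennreal (a * b)"
    by (rule ennreal_power2_le_imp_le) (use ab in simp)
  have "(\<integral>\<^sup>+x. ennreal ((f x + g x)\<^sup>2) \<partial>M) \<le>
      (\<integral>\<^sup>+x. ennreal ((f x)\<^sup>2) + (2 * (ennreal \<bar>f x\<bar> * ennreal \<bar>g x\<bar>) + ennreal ((g x)\<^sup>2)) \<partial>M)"
  proof (rule nn_integral_mono)
    fix x
    have "(f x + g x)\<^sup>2 \<le> (f x)\<^sup>2 + (2 * (\<bar>f x\<bar> * \<bar>g x\<bar>) + (g x)\<^sup>2)"
      using abs_ge_self[of "f x * g x"] by (simp add: power2_sum abs_mult)
    then have "ennreal ((f x + g x)\<^sup>2) \<le> ennreal ((f x)\<^sup>2 + (2 * (\<bar>f x\<bar> * \<bar>g x\<bar>) + (g x)\<^sup>2))" by (rule ennreal_leI)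
    then show "ennreal ((f x + g x)\<^sup>2) \<le> ennreal ((f x)\<^sup>2) + (2 * (ennreal \<bar>f x\<bar> * ennreal \<bar>g x\<bar>) + ennreal ((g x)\<^sup>2))"
      by (simp add: ennreal_mult)
  qed
  also have "\<dots> = (\<integral>\<^sup>+x. ennreal ((f x)\<^sup>2) \<partial>M) + (2 * (\<integral>\<^sup>+x. ennreal \<bar>f x\<bar> * ennreal \<bar>g x\<bar> \<partial>M) + (\<integral>\<^sup>+x. ennreal ((g x)\<^sup>2) \<partial>M))"
    by (simp add: nn_integral_add nn_integral_cmult)
  also have "\<dots> \<le> ennreal (a\<^sup>2) + (2 * ennreal (a * b) + ennreal (b\<^sup>2))"
    by (intro add_mono mult_left_mono f g fg) simp
  also have "2 * ennreal (a * b) = ennreal (2 * (a * b))" using ab by (simp add: ennreal_mult)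
  also have "ennreal (a\<^sup>2) + (ennreal (2 * (a * b)) + ennreal (b\<^sup>2)) = ennreal ((a + b)\<^sup>2)"
    using ab by (subst ennreal_plus[symmetric], simp, simp)+ (simp add: power2_sum algebra_simps)
  finally show ?thesis .
qed

lemma grad_norm_triangle:
  assumes f: "f \<in> C1_compact" and g: "g \<in> C1_compact"
  shows "grad_norm f \<le> grad_norm g + grad_norm (\<lambda>x. f x - g x)"
proof (rule grad_norm_leI[OF f])
  note [measurable] = C1_compact_measurable[OF f] C1_compact_measurable[OF g]
  note d = C1_compact_diff[OF f g]
  have "(\<integral>\<^sup>+x. ennreal ((norm (grad f x))\<^sup>2) \<partial>lborel) \<le>
      (\<integral>\<^sup>+x. ennreal ((norm (grad g x) + norm (grad f x - grad g x))\<^sup>2) \<partial>lborel)"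
  proof (intro nn_integral_mono ennreal_leI power_mono)
    show "norm (grad f x) \<le> norm (grad g x) + norm (grad f x - grad g x)" for x
      using norm_triangle_sub[of "grad f x" "grad g x"] .
  qed simp
  also have "\<dots> \<le> ennreal ((grad_norm g + grad_norm (\<lambda>x. f x - g x))\<^sup>2)"
    using nn_integral_grad[OF g] nn_integral_grad[OF d(1)] unfolding d(2)
    by (intro nn_integral_power2_add_le) (auto simp: grad_norm_nonneg)
  finally show "(\<integral>\<^sup>+x. ennreal ((norm (grad f x))\<^sup>2) \<partial>lborel) \<le> ennreal ((grad_norm g + grad_norm (\<lambda>x. f x - g x))\<^sup>2)" .
qed (simp add: grad_norm_nonneg)

lemma grad_norm_minus_commute:
  assumes f: "f \<in> C1_compact" and g: "g \<in> C1_compact"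
  shows "grad_norm (\<lambda>x. f x - g x) = grad_norm (\<lambda>x. g x - f x)"
  unfolding grad_norm_def C1_compact_diff(2)[OF f g] C1_compact_diff(2)[OF g f]
  by (simp add: norm_minus_commute)

text \<open>The increment integrates the directional derivative along the segment from
  \<open>x\<close> to \<open>x + h\<close>; then Cauchy-Schwarz in the parameter, Fubini and
  translation invariance. This is the source of \<open>shift\<close>.\<close>

lemma C1_compact_shift:
  fixes f :: "real^'n \<Rightarrow> real"
  assumes f: "f \<in> C1_compact"
  shows "(\<integral>\<^sup>+x. ennreal ((f (x + h) - f x)\<^sup>2) \<partial>lborel) \<le> ennreal ((grad_norm f * norm h)\<^sup>2)"
proof -
  have cont: "continuous_on UNIV (grad f)" and df: "f differentiable (at x)" for x
    using f by (auto simp: C1_compact_def)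
  note [measurable] = C1_compact_measurable[OF f]
  let ?I = "indicator {0..1::real}"
  have pt: "ennreal ((f (x + h) - f x)\<^sup>2) \<le>
      (\<integral>\<^sup>+t. ennreal ((norm h)\<^sup>2) * (ennreal ((norm (grad f (x + t *\<^sub>R h)))\<^sup>2) * ?I t) \<partial>lborel)" for x
  proof -
    have "(LINT t|lborel. ?I t *\<^sub>R (grad f (x + t *\<^sub>R h) \<bullet> h)) = f (x + 1 *\<^sub>R h) - f (x + 0 *\<^sub>R h)"
    proof (rule integral_FTC_Icc)
      fix t :: real
      have "((\<lambda>t. x + t *\<^sub>R h) has_vector_derivative h) (at t within {0..1})"
        by (auto intro!: derivative_eq_intros simp: has_vector_derivative_def)
      from vector_derivative_diff_chain_within[OF this, of f "\<lambda>k. grad f (x + t *\<^sub>R h) \<bullet> k"]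
      show "((\<lambda>t. f (x + t *\<^sub>R h)) has_vector_derivative grad f (x + t *\<^sub>R h) \<bullet> h) (at t within {0..1})"
        using has_derivative_grad[OF df] by (auto simp: o_def intro: has_derivative_at_withinI)
      show "continuous_on {0..1} (\<lambda>t. grad f (x + t *\<^sub>R h) \<bullet> h)"
        by (intro continuous_intros continuous_on_compose2[OF cont]) auto
    qed simp
    then have "f (x + h) - f x = (LINT t|lborel. ?I t *\<^sub>R (grad f (x + t *\<^sub>R h) \<bullet> h))" by simp
    moreover have "integrable lborel (\<lambda>t. ?I t *\<^sub>R (grad f (x + t *\<^sub>R h) \<bullet> h))"
      by (rule borel_integrable_compact) (auto intro!: continuous_intros continuous_on_compose2[OF cont])
    ultimately have "ennreal \<bar>f (x + h) - f x\<bar> \<le> (\<integral>\<^sup>+t. ennreal \<bar>?I t * (grad f (x + t *\<^sub>R h) \<bullet> h)\<bar> \<partial>lborel)"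
      using integral_norm_bound_ennreal[of lborel "\<lambda>t. ?I t *\<^sub>R (grad f (x + t *\<^sub>R h) \<bullet> h)"] by simp
    \<comment> \<open>The inserted indicator is the second factor for Cauchy-Schwarz and has
      integral 1.\<close>
    also have "\<dots> = (\<integral>\<^sup>+t. ennreal \<bar>?I t * (grad f (x + t *\<^sub>R h) \<bullet> h)\<bar> * ?I t \<partial>lborel)"
      by (intro nn_integral_cong) (auto simp: indicator_def)
    finally have "(ennreal \<bar>f (x + h) - f x\<bar>)\<^sup>2 \<le> (\<integral>\<^sup>+t. ennreal \<bar>?I t * (grad f (x + t *\<^sub>R h) \<bullet> h)\<bar> * ?I t \<partial>lborel)\<^sup>2"
      by (rule power_mono) simp
    also have "\<dots> \<le> (\<integral>\<^sup>+t. (ennreal \<bar>?I t * (grad f (x + t *\<^sub>R h) \<bullet> h)\<bar>)\<^sup>2 \<partial>lborel) * (\<integral>\<^sup>+t. (?I t)\<^sup>2 \<partial>lborel)"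
      by (rule Cauchy_Schwarz_nn_integral) auto
    also have "(\<integral>\<^sup>+t. (?I t)\<^sup>2 \<partial>lborel) = (\<integral>\<^sup>+t. ?I t \<partial>lborel)"
      by (intro nn_integral_cong) (auto simp: indicator_def)
    also have "\<dots> = 1" by simp
    also have "(\<integral>\<^sup>+t. (ennreal \<bar>?I t * (grad f (x + t *\<^sub>R h) \<bullet> h)\<bar>)\<^sup>2 \<partial>lborel) * 1 \<le>
        (\<integral>\<^sup>+t. ennreal ((norm h)\<^sup>2) * (ennreal ((norm (grad f (x + t *\<^sub>R h)))\<^sup>2) * ?I t) \<partial>lborel)"
      unfolding mult_1_right
    proof (rule nn_integral_mono)
      fix t
      have "\<bar>grad f (x + t *\<^sub>R h) \<bullet> h\<bar>\<^sup>2 \<le> (norm (grad f (x + t *\<^sub>R h)) * norm h)\<^sup>2"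
        by (intro power_mono Cauchy_Schwarz_ineq2) simp
      then show "(ennreal \<bar>?I t * (grad f (x + t *\<^sub>R h) \<bullet> h)\<bar>)\<^sup>2 \<le>
          ennreal ((norm h)\<^sup>2) * (ennreal ((norm (grad f (x + t *\<^sub>R h)))\<^sup>2) * ?I t)"
        by (auto simp: indicator_def ennreal_power power_mult_distrib mult.commute simp flip: ennreal_mult intro!: ennreal_leI)
    qed
    finally show ?thesis by (simp add: ennreal_power)
  qed
  have "(\<integral>\<^sup>+x. ennreal ((f (x + h) - f x)\<^sup>2) \<partial>lborel) \<le>
     (\<integral>\<^sup>+x. (\<integral>\<^sup>+t. ennreal ((norm h)\<^sup>2) * (ennreal ((norm (grad f (x + t *\<^sub>R h)))\<^sup>2) * ?I t) \<partial>lborel) \<partial>lborel)"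
    by (intro nn_integral_mono pt)
  also have "\<dots> = (\<integral>\<^sup>+t. (\<integral>\<^sup>+x. ennreal ((norm h)\<^sup>2) * (ennreal ((norm (grad f (x + t *\<^sub>R h)))\<^sup>2) * ?I t) \<partial>lborel) \<partial>lborel)"
    by (rule lborel_pair.Fubini') simp
  also have "\<dots> = (\<integral>\<^sup>+t. ennreal ((norm h)\<^sup>2) * ennreal ((grad_norm f)\<^sup>2) * ?I t \<partial>lborel)"
  proof (rule nn_integral_cong)
    fix t :: real
    have "(\<integral>\<^sup>+x. ennreal ((norm (grad f (x + t *\<^sub>R h)))\<^sup>2) \<partial>lborel) = ennreal ((grad_norm f)\<^sup>2)"
      using nn_integral_lborel_shift[of "\<lambda>x. ennreal ((norm (grad f x))\<^sup>2)" "t *\<^sub>R h"]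
      by (simp add: add.commute nn_integral_grad[OF f])
    then show "(\<integral>\<^sup>+x. ennreal ((norm h)\<^sup>2) * (ennreal ((norm (grad f (x + t *\<^sub>R h)))\<^sup>2) * ?I t) \<partial>lborel) =
        ennreal ((norm h)\<^sup>2) * ennreal ((grad_norm f)\<^sup>2) * ?I t"
      by (simp add: nn_integral_cmult nn_integral_multc mult.assoc)
  qed
  also have "\<dots> = ennreal ((grad_norm f * norm h)\<^sup>2)"
    by (subst nn_integral_cmult_indicator) (auto simp: power_mult_distrib mult.commute ennreal_mult)
  finally show ?thesis .
qed

text \<open>A converse of \<open>C1_compact_shift\<close>, by Fatou on difference quotients in the
  coordinate directions. Treating the coordinates separately costs \<open>sqrt CARD('n)\<close>,
  harmless where \<open>K\<close> can be made arbitrarily small.\<close>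

lemma grad_norm_le_shift:
  fixes f :: "real^'n \<Rightarrow> real"
  assumes f: "f \<in> C1_compact" and K: "0 \<le> K"
    and shift: "\<And>h. (\<integral>\<^sup>+x. ennreal ((f (x + h) - f x)\<^sup>2) \<partial>lborel) \<le> ennreal ((K * norm h)\<^sup>2)"
  shows "grad_norm f \<le> sqrt CARD('n) * K"
proof (rule grad_norm_leI[OF f])
  note [measurable] = C1_compact_measurable[OF f]
  have df: "f differentiable (at x)" for x using f by (auto simp: C1_compact_def)
  have [measurable]: "(\<lambda>x. grad f x $ i) \<in> borel_measurable borel" for i
  proof -
    have "(\<lambda>x. grad f x \<bullet> axis i 1) \<in> borel_measurable borel" by measurable
    then show ?thesis by (simp add: inner_axis)
  qed
  have comp: "(\<integral>\<^sup>+x. ennreal ((grad f x $ i)\<^sup>2) \<partial>lborel) \<le> ennreal (K\<^sup>2)" for i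
  proof -
    define t where "t n = 1 / real (Suc n)" for n
    have t: "0 < t n" for n by (simp add: t_def)
    let ?e = "axis i 1 :: real^'n"
    let ?q = "\<lambda>n x. (f (x + t n *\<^sub>R ?e) - f x) / t n"
    have lim: "(\<lambda>n. ?q n x) \<longlonglongrightarrow> grad f x $ i" for x
    proof -
      have "((\<lambda>s. x + s *\<^sub>R ?e) has_vector_derivative ?e) (at 0)"
        by (auto intro!: derivative_eq_intros simp: has_vector_derivative_def)
      from vector_derivative_diff_chain_within[OF this, of f "\<lambda>k. grad f x \<bullet> k"]
      have "((\<lambda>s. f (x + s *\<^sub>R ?e)) has_vector_derivative grad f x \<bullet> ?e) (at 0)"
        using has_derivative_grad[OF df] by (auto simp: o_def intro: has_derivative_at_withinI)
      then have "((\<lambda>s. f (x + s *\<^sub>R ?e)) has_real_derivative grad f x $ i) (at 0)"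
        by (simp add: has_real_derivative_iff_has_vector_derivative inner_axis)
      then have "((\<lambda>s. (f (x + s *\<^sub>R ?e) - f x) / s) \<longlongrightarrow> grad f x $ i) (at 0)"
        by (simp add: has_field_derivative_iff)
      moreover have "filterlim t (at 0) sequentially"
        unfolding filterlim_at t_def using LIMSEQ_inverse_real_of_nat by (auto simp: inverse_eq_divide)
      ultimately show ?thesis by (rule filterlim_compose)
    qed
    have "(\<integral>\<^sup>+x. ennreal ((grad f x $ i)\<^sup>2) \<partial>lborel) = (\<integral>\<^sup>+x. liminf (\<lambda>n. ennreal ((?q n x)\<^sup>2)) \<partial>lborel)"
    proof (rule nn_integral_cong)
      fix x
      have "(\<lambda>n. ennreal ((?q n x)\<^sup>2)) \<longlonglongrightarrow> ennreal ((grad f x $ i)\<^sup>2)"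
        by (intro tendsto_ennrealI tendsto_power lim)
      then show "ennreal ((grad f x $ i)\<^sup>2) = liminf (\<lambda>n. ennreal ((?q n x)\<^sup>2))"
        by (intro lim_imp_Liminf[symmetric]) auto
    qed
    also have "\<dots> \<le> liminf (\<lambda>n. \<integral>\<^sup>+x. ennreal ((?q n x)\<^sup>2) \<partial>lborel)"
      by (rule nn_integral_liminf) simp
    also have "\<dots> \<le> ennreal (K\<^sup>2)"
    proof (rule Liminf_le, simp, rule always_eventually, rule allI)
      fix n
      have "(\<integral>\<^sup>+x. ennreal ((?q n x)\<^sup>2) \<partial>lborel) =
          ennreal (1 / (t n)\<^sup>2) * (\<integral>\<^sup>+x. ennreal ((f (x + t n *\<^sub>R ?e) - f x)\<^sup>2) \<partial>lborel)"
        by (subst nn_integral_cmult[symmetric]) (auto simp: power_divide simp flip: ennreal_mult)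
      also have "\<dots> \<le> ennreal (1 / (t n)\<^sup>2) * ennreal ((K * norm (t n *\<^sub>R ?e))\<^sup>2)"
        by (intro mult_left_mono shift) simp
      also have "\<dots> = ennreal (K\<^sup>2)" using t[of n] by (simp add: power_mult_distrib flip: ennreal_mult)
      finally show "(\<integral>\<^sup>+x. ennreal ((?q n x)\<^sup>2) \<partial>lborel) \<le> ennreal (K\<^sup>2)" .
    qed
    finally show ?thesis .
  qed
  have "(\<integral>\<^sup>+x. ennreal ((norm (grad f x))\<^sup>2) \<partial>lborel) = (\<integral>\<^sup>+x. (\<Sum>i\<in>UNIV. ennreal ((grad f x $ i)\<^sup>2)) \<partial>lborel)"
    by (intro nn_integral_cong) (simp add: norm_vec_def L2_set_def sum_nonneg)
  also have "\<dots> = (\<Sum>i\<in>UNIV. \<integral>\<^sup>+x. ennreal ((grad f x $ i)\<^sup>2) \<partial>lborel)"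
    by (rule nn_integral_sum) simp
  also have "\<dots> \<le> (\<Sum>i\<in>(UNIV :: 'n set). ennreal (K\<^sup>2))" by (intro sum_mono comp)
  also have "\<dots> = ennreal ((sqrt CARD('n) * K)\<^sup>2)"
    by (simp add: power_mult_distrib ennreal_mult ennreal_of_nat_eq_real_of_nat)
  finally show "(\<integral>\<^sup>+x. ennreal ((norm (grad f x))\<^sup>2) \<partial>lborel) \<le> ennreal ((sqrt CARD('n) * K)\<^sup>2)" .
qed (use K in simp)

section \<open>Elements of the completion\<close>

lemma powr_abs_diff_le:
  fixes a b c :: real
  assumes "0 \<le> c"
  shows "\<bar>a - b\<bar> powr c \<le> 2 powr c * (\<bar>a\<bar> powr c + \<bar>b\<bar> powr c)"
proof -
  have "\<bar>a - b\<bar> powr c \<le> (2 * max \<bar>a\<bar> \<bar>b\<bar>) powr c" using assms by (intro powr_mono2) auto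
  also have "\<dots> = 2 powr c * (max \<bar>a\<bar> \<bar>b\<bar>) powr c" by (simp add: powr_mult)
  also have "\<dots> \<le> 2 powr c * (\<bar>a\<bar> powr c + \<bar>b\<bar> powr c)"
    by (intro mult_left_mono) (auto simp: max_def)
  finally show ?thesis .
qed

lemma integrable_powr_diff:
  fixes f g :: "'a \<Rightarrow> real"
  assumes [measurable]: "f \<in> borel_measurable M" "g \<in> borel_measurable M" and c: "0 \<le> c"
    and int: "integrable M (\<lambda>x. \<bar>f x\<bar> powr c)" "integrable M (\<lambda>x. \<bar>g x\<bar> powr c)"
  shows "integrable M (\<lambda>x. \<bar>f x - g x\<bar> powr c)"
proof (rule Bochner_Integration.integrable_bound)
  show "integrable M (\<lambda>x. 2 powr c * (\<bar>f x\<bar> powr c + \<bar>g x\<bar> powr c))" using int by simp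
  show "AE x in M. norm (\<bar>f x - g x\<bar> powr c) \<le> norm (2 powr c * (\<bar>f x\<bar> powr c + \<bar>g x\<bar> powr c))"
    using powr_abs_diff_le[OF c] by (intro AE_I2) (simp add: order_trans[OF _ abs_ge_self])
qed simp

lemma energy_bounded_diff:
  assumes u: "energy_bounded c G u" and v: "energy_bounded c H v"
  shows "energy_bounded c (G + H) (\<lambda>x. u x - v x)"
proof -
  interpret u: energy_bounded c G u by (rule u)
  interpret v: energy_bounded c H v by (rule v)
  show ?thesis
  proof
    show "integrable lborel (\<lambda>x. \<bar>u x - v x\<bar> powr c)"
      using u.c u.integrable v.integrable by (intro integrable_powr_diff) auto
    fix h
    have "(\<integral>\<^sup>+x. ennreal ((u (x + h) - v (x + h) - (u x - v x))\<^sup>2) \<partial>lborel) =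
        (\<integral>\<^sup>+x. ennreal (((u (x + h) - u x) + (v x - v (x + h)))\<^sup>2) \<partial>lborel)"
      by (simp add: algebra_simps)
    also have "\<dots> \<le> ennreal ((G * norm h + H * norm h)\<^sup>2)"
      using u.shift[of h] v.shift[of h] u.G v.G
      by (intro nn_integral_power2_add_le) (auto simp: power2_commute[of "v _" "v (_ + _)"])
    finally show "(\<integral>\<^sup>+x. ennreal ((u (x + h) - v (x + h) - (u x - v x))\<^sup>2) \<partial>lborel) \<le> ennreal (((G + H) * norm h)\<^sup>2)"
      by (simp add: distrib_right)
  qed (use u.c u.G v.G in auto)
qed

lemma AE_lborel_shift:
  fixes h :: "'a::euclidean_space"
  assumes "AE x in lborel. P x"
  shows "AE x in lborel. P (x + h)"
proof -
  have "AE x in distr lborel borel ((+) h). P x"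
    unfolding lborel_distr_plus by (rule assms)
  then have "AE x in lborel. P (h + x)" by (rule AE_distrD[rotated]) simp
  then show ?thesis by (simp add: add.commute)
qed

text \<open>Fatou's lemma: increments of a limit are controlled by an eventual gradient bound along
  the sequence, without giving the limit a gradient.\<close>

lemma C1_compact_AE_limit_shift:
  fixes F :: "nat \<Rightarrow> real^'n \<Rightarrow> real"
  assumes F: "\<And>n. F n \<in> C1_compact" and [measurable]: "v \<in> borel_measurable borel"
    and lim: "AE x in lborel. (\<lambda>n. F n x) \<longlonglongrightarrow> v x"
    and a: "eventually (\<lambda>n. grad_norm (F n) \<le> a) sequentially"
  shows "(\<integral>\<^sup>+x. ennreal ((v (x + h) - v x)\<^sup>2) \<partial>lborel) \<le> ennreal ((a * norm h)\<^sup>2)"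
proof -
  note [measurable] = C1_compact_measurable[OF F]
  have "(\<integral>\<^sup>+x. ennreal ((v (x + h) - v x)\<^sup>2) \<partial>lborel) =
      (\<integral>\<^sup>+x. liminf (\<lambda>n. ennreal ((F n (x + h) - F n x)\<^sup>2)) \<partial>lborel)"
  proof (rule nn_integral_cong_AE)
    show "AE x in lborel. ennreal ((v (x + h) - v x)\<^sup>2) = liminf (\<lambda>n. ennreal ((F n (x + h) - F n x)\<^sup>2))"
      using lim AE_lborel_shift[OF lim, of h]
    proof eventually_elim
      fix x assume "(\<lambda>n. F n x) \<longlonglongrightarrow> v x" "(\<lambda>n. F n (x + h)) \<longlonglongrightarrow> v (x + h)"
      then have "(\<lambda>n. ennreal ((F n (x + h) - F n x)\<^sup>2)) \<longlonglongrightarrow> ennreal ((v (x + h) - v x)\<^sup>2)"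
        by (intro tendsto_ennrealI tendsto_power tendsto_diff)
      then show "ennreal ((v (x + h) - v x)\<^sup>2) = liminf (\<lambda>n. ennreal ((F n (x + h) - F n x)\<^sup>2))"
        by (intro lim_imp_Liminf[symmetric]) auto
    qed
  qed
  also have "\<dots> \<le> liminf (\<lambda>n. \<integral>\<^sup>+x. ennreal ((F n (x + h) - F n x)\<^sup>2) \<partial>lborel)"
    by (rule nn_integral_liminf) simp
  also have "\<dots> \<le> ennreal ((a * norm h)\<^sup>2)"
  proof (rule Liminf_le)
    show "eventually (\<lambda>n. (\<integral>\<^sup>+x. ennreal ((F n (x + h) - F n x)\<^sup>2) \<partial>lborel) \<le> ennreal ((a * norm h)\<^sup>2)) sequentially"
      using a
    proof eventually_elim
      fix n assume "grad_norm (F n) \<le> a"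
      then have "(grad_norm (F n) * norm h)\<^sup>2 \<le> (a * norm h)\<^sup>2"
        using grad_norm_nonneg[of "F n"] by (intro power_mono mult_right_mono) auto
      then show "(\<integral>\<^sup>+x. ennreal ((F n (x + h) - F n x)\<^sup>2) \<partial>lborel) \<le> ennreal ((a * norm h)\<^sup>2)"
        using C1_compact_shift[OF F, of n h] by (meson ennreal_leI order_trans)
    qed
  qed simp
  finally show ?thesis .
qed

lemma C1_compact_integrable_powr:
  fixes f :: "real^'n \<Rightarrow> real"
  assumes f: "f \<in> C1_compact" and c: "0 < c"
  shows "integrable lborel (\<lambda>x. \<bar>f x\<bar> powr c)"
proof -
  let ?K = "closure {x. f x \<noteq> 0}"
  have cont: "continuous_on ?K f" using C1_compact_continuous[OF f] by (rule continuous_on_subset) simp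
  have "integrable lborel (\<lambda>x. indicator ?K x *\<^sub>R (\<bar>f x\<bar> powr c))"
    using f c cont by (intro borel_integrable_compact continuous_on_powr' continuous_intros) (auto simp: C1_compact_def)
  also have "(\<lambda>x. indicator ?K x *\<^sub>R (\<bar>f x\<bar> powr c)) = (\<lambda>x. \<bar>f x\<bar> powr c)"
    using closure_subset[of "{x. f x \<noteq> 0}"] by (auto simp: fun_eq_iff indicator_def)
  finally show ?thesis .
qed

section \<open>Representing sequences and the extended gradient norm\<close>

lemma critical_exp_gt_2: "3 \<le> N \<Longrightarrow> 2 < critical_exp N"
  by (simp add: critical_exp_def field_simps)

text \<open>Convergence in the critical norm is \<open>L^1\<close> convergence to 0 of powers of the
  differences, which yields an almost-everywhere convergent subsequence. Starting from a given
  \<open>r\<close> allows two representing sequences to be refined together.\<close>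

lemma D12_approx_AE_subseq:
  fixes u :: "real^'n \<Rightarrow> real"
  assumes N: "3 \<le> CARD('n)" and ap: "D12_approx \<phi> u" and r: "strict_mono (r :: nat \<Rightarrow> nat)"
  obtains r' where "strict_mono (r' :: nat \<Rightarrow> nat)" "AE x in lborel. (\<lambda>n. \<phi> (r (r' n)) x) \<longlonglongrightarrow> u x"
proof -
  let ?c = "critical_exp CARD('n)"
  have c: "0 < ?c" using critical_exp_gt_2[OF N] by simp
  have \<phi>: "\<phi> n \<in> C1_compact" for n using ap C0_infty_C1_compact by (auto simp: D12_approx_def)
  have u: "u \<in> borel_measurable lebesgue" "integrable lebesgue (\<lambda>x. \<bar>u x\<bar> powr ?c)"
    using ap by (auto simp: D12_approx_def Lp_def)
  have lim0: "(\<lambda>n. Lp_norm ?c (\<lambda>x. \<phi> n x - u x)) \<longlonglongrightarrow> 0" using ap by (simp add: D12_approx_def)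
  let ?f = "\<lambda>n x. \<bar>\<phi> (r n) x - u x\<bar> powr ?c"
  have int: "integrable lebesgue (?f n)" for n
  proof (rule integrable_powr_diff)
    show "integrable lebesgue (\<lambda>x. \<bar>\<phi> (r n) x\<bar> powr ?c)"
      using C1_compact_integrable_powr[OF \<phi> c] C1_compact_measurable[OF \<phi>] by (subst integrable_completion) auto
    show "\<phi> (r n) \<in> borel_measurable lebesgue"
      by (rule measurable_completion) (use C1_compact_measurable[OF \<phi>] in simp)
  qed (use u c in auto)
  have "(\<lambda>n. Lp_norm ?c (\<lambda>x. \<phi> (r n) x - u x) powr ?c) \<longlonglongrightarrow> 0 powr ?c"
    using LIMSEQ_subseq_LIMSEQ[OF lim0 r] c
    by (intro tendsto_powr' tendsto_const) (auto simp: o_def Lp_norm_def)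
  moreover have "Lp_norm ?c (\<lambda>x. \<phi> (r n) x - u x) powr ?c = (LINT x|lebesgue. norm (?f n x))" for n
    using c by (simp add: Lp_norm_def powr_powr)
  ultimately have "(\<lambda>n. LINT x|lebesgue. norm (?f n x)) \<longlonglongrightarrow> 0" by simp
  from tendsto_L1_AE_subseq[OF int this]
  obtain r' where r': "strict_mono r'" "AE x in lebesgue. (\<lambda>n. ?f (r' n) x) \<longlonglongrightarrow> 0" by blast
  from r'(2) have "AE x in lborel. (\<lambda>n. ?f (r' n) x) \<longlonglongrightarrow> 0" by (simp only: AE_completion_iff)
  then have "AE x in lborel. (\<lambda>n. \<phi> (r (r' n)) x) \<longlonglongrightarrow> u x"
  proof eventually_elim
    fix x assume "(\<lambda>n. ?f (r' n) x) \<longlonglongrightarrow> 0"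
    then have "(\<lambda>n. ?f (r' n) x powr (1 / ?c)) \<longlonglongrightarrow> 0 powr (1 / ?c)"
      using c by (intro tendsto_powr' tendsto_const) auto
    then have "(\<lambda>n. \<bar>\<phi> (r (r' n)) x - u x\<bar>) \<longlonglongrightarrow> 0" using c by (simp add: powr_powr)
    then show "(\<lambda>n. \<phi> (r (r' n)) x) \<longlonglongrightarrow> u x" by (simp add: tendsto_rabs_zero_iff LIM_zero_iff)
  qed
  with r'(1) show thesis by (rule that)
qed

lemma D12_approx_C1_compact: "D12_approx \<phi> u \<Longrightarrow> \<phi> n \<in> C1_compact"
  by (simp add: D12_approx_def C0_infty_C1_compact)

lemma D12_approx_grad_norm_convergent:
  assumes ap: "D12_approx \<phi> u"
  shows "convergent (\<lambda>n. grad_norm (\<phi> n))"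
proof (rule Cauchy_convergent, rule CauchyI)
  fix e :: real assume "0 < e"
  then obtain M where M: "\<And>k l. M \<le> k \<Longrightarrow> M \<le> l \<Longrightarrow> grad_norm (\<lambda>x. \<phi> k x - \<phi> l x) < e"
    using ap unfolding D12_approx_def by meson
  note \<phi> = D12_approx_C1_compact[OF ap]
  have "norm (grad_norm (\<phi> k) - grad_norm (\<phi> l)) < e" if "M \<le> k" "M \<le> l" for k l
    using grad_norm_triangle[OF \<phi> \<phi>, of k l] grad_norm_triangle[OF \<phi> \<phi>, of l k] M[OF that] M[OF that(2,1)]
    by simp
  then show "\<exists>M. \<forall>k\<ge>M. \<forall>l\<ge>M. norm (grad_norm (\<phi> k) - grad_norm (\<phi> l)) < e" by blast
qed

text \<open>
  Instead of integrating by parts, the uniqueness of the limit gradient is read off from difference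
  quotients: if \<open>w = \<phi> n - \<psi> n\<close> and the functions \<open>\<phi> m - \<psi> m\<close> tend to 0 almost everywhere, then by Fatou
  the increments of \<open>w\<close> are controlled by the gradients of \<open>w - (\<phi> m - \<psi> m)\<close>, which are small.
\<close>

lemma D12_approx_grad_norm_diff:
  fixes u :: "real^'n \<Rightarrow> real"
  assumes N: "3 \<le> CARD('n)" and ap: "D12_approx \<phi> u" and ap': "D12_approx \<psi> u"
  shows "(\<lambda>n. grad_norm (\<phi> n) - grad_norm (\<psi> n)) \<longlonglongrightarrow> 0"
proof (rule LIMSEQ_I)
  fix e :: real assume e: "0 < e"
  \<comment> \<open>Chosen so that \<open>sqrt CARD('n)\<close> times the increment bound
    \<open>2 * d\<close> equals \<open>e / 2\<close>.\<close>
  define d where "d = e / (4 * sqrt CARD('n))"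
  have d: "0 < d" using e by (simp add: d_def)
  note \<phi> = D12_approx_C1_compact[OF ap] and \<psi> = D12_approx_C1_compact[OF ap']
  obtain M1 where M1: "\<And>k l. M1 \<le> k \<Longrightarrow> M1 \<le> l \<Longrightarrow> grad_norm (\<lambda>x. \<phi> k x - \<phi> l x) < d"
    using ap d unfolding D12_approx_def by meson
  obtain M2 where M2: "\<And>k l. M2 \<le> k \<Longrightarrow> M2 \<le> l \<Longrightarrow> grad_norm (\<lambda>x. \<psi> k x - \<psi> l x) < d"
    using ap' d unfolding D12_approx_def by meson
  obtain r1 where r1: "strict_mono r1" "AE x in lborel. (\<lambda>n. \<phi> (r1 n) x) \<longlonglongrightarrow> u x"
    using D12_approx_AE_subseq[OF N ap strict_mono_id] by auto
  \<comment> \<open>Refining \<open>r1\<close> makes both sequences converge along the common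
    subsequence \<open>r\<close>.\<close>
  obtain r2 where r2: "strict_mono r2" "AE x in lborel. (\<lambda>n. \<psi> (r1 (r2 n)) x) \<longlonglongrightarrow> u x"
    using D12_approx_AE_subseq[OF N ap' r1(1)] by auto
  define r where "r n = r1 (r2 n)" for n
  have r: "strict_mono r" using r1(1) r2(1) by (simp add: r_def strict_mono_def)
  show "\<exists>n0. \<forall>n\<ge>n0. norm (grad_norm (\<phi> n) - grad_norm (\<psi> n) - 0) < e"
  proof (intro exI allI impI)
    fix n assume n: "max M1 M2 \<le> n"
    let ?w = "\<lambda>n x. \<phi> n x - \<psi> n x"
    have w: "?w k \<in> C1_compact" for k by (rule C1_compact_diff(1)[OF \<phi> \<psi>])
    have "grad_norm (?w n) \<le> sqrt CARD('n) * (2 * d)"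
    proof (rule grad_norm_le_shift[OF w])
      fix h
      show "(\<integral>\<^sup>+x. ennreal ((?w n (x + h) - ?w n x)\<^sup>2) \<partial>lborel) \<le> ennreal ((2 * d * norm h)\<^sup>2)"
      proof (rule C1_compact_AE_limit_shift[where F = "\<lambda>m x. ?w n x - ?w (r m) x"])
        show "(\<lambda>x. ?w n x - ?w (r m) x) \<in> C1_compact" for m by (rule C1_compact_diff(1)[OF w w])
        show "?w n \<in> borel_measurable borel" by (rule C1_compact_measurable[OF w])
        show "AE x in lborel. (\<lambda>m. ?w n x - ?w (r m) x) \<longlonglongrightarrow> ?w n x"
          using r1(2) r2(2)
        proof eventually_elim
          fix x assume 1: "(\<lambda>n. \<phi> (r1 n) x) \<longlonglongrightarrow> u x" and 2: "(\<lambda>n. \<psi> (r1 (r2 n)) x) \<longlonglongrightarrow> u x"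
          have "(\<lambda>m. ?w n x - ?w (r m) x) \<longlonglongrightarrow> ?w n x - (u x - u x)"
            using LIMSEQ_subseq_LIMSEQ[OF 1 r2(1)] 2 unfolding r_def o_def by (intro tendsto_intros)
          then show "(\<lambda>m. ?w n x - ?w (r m) x) \<longlonglongrightarrow> ?w n x" by simp
        qed
        show "eventually (\<lambda>m. grad_norm (\<lambda>x. ?w n x - ?w (r m) x) \<le> 2 * d) sequentially"
        proof (rule eventually_sequentiallyI)
          fix m assume "max M1 M2 \<le> m"
          then have m: "M1 \<le> r m" "M2 \<le> r m" using seq_suble[OF r, of m] by auto
          let ?a = "\<lambda>x. \<phi> n x - \<phi> (r m) x" and ?b = "\<lambda>x. \<psi> n x - \<psi> (r m) x"
          have a: "?a \<in> C1_compact" and b: "?b \<in> C1_compact" by (auto intro: C1_compact_diff \<phi> \<psi>)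
          note ab = C1_compact_diff(1)[OF a b]
          have "grad_norm (\<lambda>x. ?a x - ?b x) \<le> grad_norm ?a + grad_norm (\<lambda>x. (?a x - ?b x) - ?a x)"
            by (rule grad_norm_triangle[OF ab a])
          also have "(\<lambda>x. (?a x - ?b x) - ?a x) = (\<lambda>x. \<psi> (r m) x - \<psi> n x)" by auto
          also have "grad_norm ?a + grad_norm (\<lambda>x. \<psi> (r m) x - \<psi> n x) \<le> 2 * d"
            using M1[of n "r m"] M2[of "r m" n] m n by simp
          also have "(\<lambda>x. ?a x - ?b x) = (\<lambda>x. ?w n x - ?w (r m) x)" by auto
          finally show "grad_norm (\<lambda>x. ?w n x - ?w (r m) x) \<le> 2 * d" .
        qed
      qed
    qed (use d in simp)
    also have "\<dots> = e / 2" by (simp add: d_def)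
    also have "\<dots> < e" using e by simp
    finally have "grad_norm (?w n) < e" .
    then show "norm (grad_norm (\<phi> n) - grad_norm (\<psi> n) - 0) < e"
      using grad_norm_triangle[OF \<phi> \<psi>, of n n] grad_norm_triangle[OF \<psi> \<phi>, of n n]
        grad_norm_minus_commute[OF \<phi> \<psi>, of n n] by simp
  qed
qed

text \<open>The definite description in \<open>D12_norm\<close> is legitimate: a limit exists
  because the gradient norms are Cauchy, and by \<open>D12_approx_grad_norm_diff\<close> it is the
  same for all representing sequences.\<close>

lemma D12_norm_approx:
  fixes u :: "real^'n \<Rightarrow> real"
  assumes N: "3 \<le> CARD('n)" and u: "u \<in> D12"
  obtains \<phi> where "D12_approx \<phi> u" "(\<lambda>n. grad_norm (\<phi> n)) \<longlonglongrightarrow> D12_norm u"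
proof -
  obtain \<phi> where \<phi>: "D12_approx \<phi> u" using u by (auto simp: D12_def)
  obtain L where L: "(\<lambda>n. grad_norm (\<phi> n)) \<longlonglongrightarrow> L"
    using D12_approx_grad_norm_convergent[OF \<phi>] by (auto simp: convergent_def)
  have "\<exists>!L. \<exists>\<phi>. D12_approx \<phi> u \<and> (\<lambda>n. grad_norm (\<phi> n)) \<longlonglongrightarrow> L"
  proof (rule ex1I)
    show "\<exists>\<phi>. D12_approx \<phi> u \<and> (\<lambda>n. grad_norm (\<phi> n)) \<longlonglongrightarrow> L" using \<phi> L by blast
    fix L' assume "\<exists>\<phi>. D12_approx \<phi> u \<and> (\<lambda>n. grad_norm (\<phi> n)) \<longlonglongrightarrow> L'"
    then obtain \<psi> where \<psi>: "D12_approx \<psi> u" "(\<lambda>n. grad_norm (\<psi> n)) \<longlonglongrightarrow> L'" by blast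
    have "(\<lambda>n. grad_norm (\<psi> n) - grad_norm (\<phi> n)) \<longlonglongrightarrow> L' - L" by (intro tendsto_diff \<psi> L)
    from LIMSEQ_unique[OF this D12_approx_grad_norm_diff[OF N \<psi>(1) \<phi>]] show "L' = L" by simp
  qed
  then have "\<exists>\<phi>. D12_approx \<phi> u \<and> (\<lambda>n. grad_norm (\<phi> n)) \<longlonglongrightarrow> D12_norm u"
    unfolding D12_norm_def by (rule theI')
  then show thesis using that by blast
qed

lemma D12_norm_nonneg:
  fixes u :: "real^'n \<Rightarrow> real"
  assumes N: "3 \<le> CARD('n)" and u: "u \<in> D12"
  shows "0 \<le> D12_norm u"
proof -
  obtain \<phi> where "D12_approx \<phi> u" "(\<lambda>n. grad_norm (\<phi> n)) \<longlonglongrightarrow> D12_norm u" using D12_norm_approx[OF N u] .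
  from this(2) show ?thesis by (rule LIMSEQ_le_const) (simp add: grad_norm_nonneg)
qed

text \<open>One \<open>v\<close> works for every \<open>G\<close> above the norm, so
  \<open>G\<close> can later be sent down to it. The strict inequality makes the gradient norms
  along a representing subsequence eventually at most \<open>G\<close>.\<close>

lemma D12_borel_representative:
  fixes u :: "real^'n \<Rightarrow> real"
  assumes N: "3 \<le> CARD('n)" and u: "u \<in> D12"
  obtains v where "AE x in lborel. u x = v x"
    "\<And>G. D12_norm u < G \<Longrightarrow> energy_bounded (critical_exp CARD('n)) G v"
proof -
  let ?c = "critical_exp CARD('n)"
  obtain \<phi> where \<phi>: "D12_approx \<phi> u" "(\<lambda>n. grad_norm (\<phi> n)) \<longlonglongrightarrow> D12_norm u" using D12_norm_approx[OF N u] .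
  have um: "u \<in> borel_measurable lebesgue" and ui: "integrable lebesgue (\<lambda>x. \<bar>u x\<bar> powr ?c)"
    using \<phi>(1) by (auto simp: D12_approx_def Lp_def)
  obtain v where v [measurable]: "v \<in> borel_measurable borel" and uv: "AE x in lborel. u x = v x"
    using completion_ex_borel_measurable_real[OF um] by auto
  obtain r where r: "strict_mono r" "AE x in lborel. (\<lambda>n. \<phi> (r n) x) \<longlonglongrightarrow> u x"
    using D12_approx_AE_subseq[OF N \<phi>(1) strict_mono_id] by auto
  have lim: "AE x in lborel. (\<lambda>n. \<phi> (r n) x) \<longlonglongrightarrow> v x" using r(2) uv by eventually_elim simp
  show thesis
  proof
    show "AE x in lborel. u x = v x" by (rule uv)
    fix G assume G: "D12_norm u < G"
    show "energy_bounded ?c G v"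
    proof
      show "1 \<le> ?c" using critical_exp_gt_2[OF N] by simp
      show "0 \<le> G" using D12_norm_nonneg[OF N u] G by simp
      have "AE x in lebesgue. \<bar>u x\<bar> powr ?c = \<bar>v x\<bar> powr ?c" using AE_completion[OF uv] by eventually_elim simp
      then have "integrable lebesgue (\<lambda>x. \<bar>v x\<bar> powr ?c)"
        by (rule integrable_cong_AE_imp[OF ui, rotated]) (rule measurable_completion, simp)
      then show "integrable lborel (\<lambda>x. \<bar>v x\<bar> powr ?c)" by (simp add: integrable_completion)
      show "(\<integral>\<^sup>+x. ennreal ((v (x + h) - v x)\<^sup>2) \<partial>lborel) \<le> ennreal ((G * norm h)\<^sup>2)" for h
      proof (rule C1_compact_AE_limit_shift[OF _ v lim])
        show "\<phi> (r n) \<in> C1_compact" for n by (rule D12_approx_C1_compact[OF \<phi>(1)])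
        have "eventually (\<lambda>n. grad_norm (\<phi> (r n)) < G) sequentially"
          using LIMSEQ_subseq_LIMSEQ[OF \<phi>(2) r(1)] G unfolding o_def by (rule order_tendstoD)
        then show "eventually (\<lambda>n. grad_norm (\<phi> (r n)) \<le> G) sequentially" by eventually_elim simp
      qed
    qed simp
  qed
qed

section \<open>Compactness\<close>

lemma ball_mean_diff:
  assumes u: "energy_bounded c G u" and v: "energy_bounded c H v" and s: "0 < s"
  shows "ball_mean s (\<lambda>x. u x - v x) x = ball_mean s u x - ball_mean s v x"
  unfolding ball_mean_def
  by (rule Bochner_Integration.integral_diff)
    (rule energy_bounded.integrable_ball_measure[OF u s] energy_bounded.integrable_ball_measure[OF v s])+

text \<open>The inclusion of level sets from \<open>weak_type\<close>, but with smallness of the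
  mean as a hypothesis, so that the radius stays free and the bound can be made small.\<close>

lemma (in energy_bounded) emeasure_superlevel_le_ball_mean:
  assumes s: "0 < s" and d: "0 < d" and small: "\<And>x. \<bar>ball_mean s u x\<bar> \<le> d / 2"
  shows "emeasure lborel {x. d < \<bar>u x\<bar>} \<le> ennreal ((G * s)\<^sup>2 / (d / 2)\<^sup>2)"
proof -
  have [measurable]: "ball_mean s u \<in> borel_measurable borel" using s by (rule ball_mean_measurable)
  have "d / 2 \<le> \<bar>u x - ball_mean s u x\<bar>" if "d < \<bar>u x\<bar>" for x
    using small[of x] that by linarith
  then have "{x. d < \<bar>u x\<bar>} \<subseteq> {x \<in> space lborel. d / 2 \<le> \<bar>u x - ball_mean s u x\<bar>}" by auto
  then have "emeasure lborel {x. d < \<bar>u x\<bar>} \<le> emeasure lborel {x \<in> space lborel. d / 2 \<le> \<bar>u x - ball_mean s u x\<bar>}"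
    by (rule emeasure_mono) simp
  also have "\<dots> \<le> ennreal ((G * s)\<^sup>2 / (d / 2)\<^sup>2)"
    by (rule emeasure_ge_le_nn_integral_power2[OF _ _ nn_integral_diff_ball_mean[OF s]]) (use d in auto)
  finally show ?thesis .
qed

text \<open>The Arzela-Ascoli argument: decay handles the outside of a ball, and inside it the
  common Lipschitz bound spreads convergence from finitely many points of the dense set.\<close>

lemma ball_mean_uniformly_Cauchy:
  fixes v :: "nat \<Rightarrow> 'a::euclidean_space \<Rightarrow> real"
  assumes v: "\<And>n. energy_bounded c G (v n)" and s: "0 < s" and e: "0 < e"
    and decay: "\<And>n x. R \<le> norm x \<Longrightarrow> \<bar>ball_mean s (v n) x\<bar> \<le> e / 2"
    and dense: "\<And>X :: 'a set. open X \<Longrightarrow> X \<noteq> {} \<Longrightarrow> \<exists>x\<in>D. x \<in> X"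
    and conv: "\<And>x. x \<in> D \<Longrightarrow> Cauchy (\<lambda>n. ball_mean s (v n) x)"
  obtains n0 where "\<forall>i\<ge>n0. \<forall>j\<ge>n0. \<forall>x. \<bar>ball_mean s (v i) x - ball_mean s (v j) x\<bar> \<le> e"
proof -
  define L where "L = G / sqrt (ball_vol TYPE('a) s)"
  have L: "0 \<le> L" using energy_bounded.G[OF v] s by (simp add: L_def)
  \<comment> \<open>Gives \<open>L * \<delta> \<le> e / 3\<close>; \<open>L + 1\<close> covers
    \<open>L = 0\<close>.\<close>
  define \<delta> where "\<delta> = e / (3 * (L + 1))"
  have \<delta>: "0 < \<delta>" using e L by (simp add: \<delta>_def)
  have "L * \<delta> = e / 3 * (L / (L + 1))" using L by (simp add: \<delta>_def)
  also have "\<dots> \<le> e / 3" using L e by (intro mult_left_le) auto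
  finally have L\<delta>: "L * \<delta> \<le> e / 3" .
  have "cball 0 R \<subseteq> (\<Union>y\<in>D. ball y \<delta>)"
  proof
    fix x :: 'a
    obtain y where "y \<in> D" "y \<in> ball x \<delta>" using dense[of "ball x \<delta>"] \<delta> by auto
    then show "x \<in> (\<Union>y\<in>D. ball y \<delta>)" by (auto simp: dist_commute)
  qed
  then obtain D' where D': "D' \<subseteq> D" "finite D'" "cball 0 R \<subseteq> (\<Union>y\<in>D'. ball y \<delta>)"
    using compactE_image[OF compact_cball, of D "\<lambda>y. ball y \<delta>" 0 R] by auto
  have "\<exists>n0. \<forall>i\<ge>n0. \<forall>j\<ge>n0. \<bar>ball_mean s (v i) y - ball_mean s (v j) y\<bar> < e / 3" if "y \<in> D'" for y
    using CauchyD[OF conv, of y "e / 3"] that D'(1) e by auto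
  then obtain n where n: "\<And>y i j. y \<in> D' \<Longrightarrow> n y \<le> i \<Longrightarrow> n y \<le> j \<Longrightarrow> \<bar>ball_mean s (v i) y - ball_mean s (v j) y\<bar> < e / 3"
    by metis
  define n0 where "n0 = (\<Sum>y\<in>D'. n y)"
  have nn0: "n y \<le> n0" if "y \<in> D'" for y using member_le_sum[of y D' n] that D'(2) by (simp add: n0_def)
  show thesis
  proof (rule that[of n0], intro allI impI)
    fix i j x assume ij: "n0 \<le> i" "n0 \<le> j"
    show "\<bar>ball_mean s (v i) x - ball_mean s (v j) x\<bar> \<le> e"
    proof (cases "R \<le> norm x")
      case True
      then show ?thesis using decay[OF True, of i] decay[OF True, of j] by linarith
    next
      case False
      then have "x \<in> cball 0 R" by simp
      then obtain y where y: "y \<in> D'" "dist y x < \<delta>" using D'(3) by auto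
      have lip: "\<bar>ball_mean s (v k) x - ball_mean s (v k) y\<bar> \<le> e / 3" for k
      proof -
        have "\<bar>ball_mean s (v k) (y + (x - y)) - ball_mean s (v k) y\<bar> \<le> L * norm (x - y)"
          using energy_bounded.ball_mean_Lipschitz[OF v s, of k y "x - y"] by (simp add: L_def)
        also have "\<dots> \<le> L * \<delta>" using y L by (intro mult_left_mono) (auto simp: dist_norm norm_minus_commute)
        finally show ?thesis using L\<delta> by simp
      qed
      have "\<bar>ball_mean s (v i) y - ball_mean s (v j) y\<bar> < e / 3"
        using nn0[OF y(1)] ij by (intro n y(1)) auto
      then show ?thesis using lip[of i] lip[of j] by linarith
    qed
  qed
qed

text \<open>One diagonal extraction over the countably many pairs of a dense point and a radius
  serves all \<open>s k\<close>. For given \<open>d\<close> and \<open>e\<close> the radius is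
  chosen first, to make the \<open>L^2\<close> error small, and only then the index from which the
  means at that radius are close.\<close>

lemma block_radial_Cauchy_in_measure_subseq:
  fixes v :: "nat \<Rightarrow> real^'n \<Rightarrow> real" and b :: "'n \<Rightarrow> nat"
  assumes N: "3 \<le> CARD('n)"
    and v: "\<And>n. energy_bounded c G (v n)" and rad: "\<And>n. AE_block_radial m b (v n)"
    and blocks: "\<And>j. b j \<in> {1..m}" "\<And>j. \<exists>j'. j' \<noteq> j \<and> b j' = b j"
  obtains r where "strict_mono (r :: nat \<Rightarrow> nat)"
    "\<forall>d>0. \<forall>e>0. \<exists>n0. \<forall>i\<ge>n0. \<forall>j\<ge>n0.
      emeasure lborel {x. d < \<bar>v (r i) x - v (r j) x\<bar>} \<le> ennreal e"
proof -
  have G: "0 \<le> G" by (rule energy_bounded.G[OF v])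
  obtain D :: "(real^'n) set" where D: "countable D" "\<And>X. open X \<Longrightarrow> X \<noteq> {} \<Longrightarrow> \<exists>x\<in>D. x \<in> X"
    using countable_dense_exists by blast
  define s where "s k = 1 / real (Suc k)" for k
  have s: "0 < s k" for k by (simp add: s_def)
  \<comment> \<open>The bounds vary with \<open>k\<close>; dividing by \<open>M k\<close> puts all
    values in \<open>[-1, 1]\<close> for the diagonal extraction, and the added 1 keeps
    \<open>M k\<close> positive.\<close>
  define M where "M k = mean_const CARD('n) * G * s k powr (1 - CARD('n) / 2) + 1" for k
  have M: "0 < M k" for k using mean_const_pos[OF N] G by (simp add: M_def add_nonneg_pos)
  have bd: "\<bar>ball_mean (s k) (v n) x\<bar> \<le> M k" for k n x
    using energy_bounded.ball_mean_bound[OF v _ s, of k n x] N by (simp add: M_def)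
  obtain r where r: "strict_mono (r :: nat \<Rightarrow> nat)"
    "\<And>z. z \<in> D \<times> UNIV \<Longrightarrow> \<exists>l. (\<lambda>n. ball_mean (s (snd z)) (v (r n)) (fst z) / M (snd z)) \<longlonglongrightarrow> l"
  proof (rule function_convergent_subsequence[where S = "D \<times> (UNIV :: nat set)" and M = 1
        and f = "\<lambda>n z. ball_mean (s (snd z)) (v n) (fst z) / M (snd z)"])
    show "norm (ball_mean (s (snd z)) (v n) (fst z) / M (snd z)) \<le> 1" for n z
      using bd[of "snd z" n "fst z"] M[of "snd z"] by (simp add: divide_le_eq)
  qed (use D(1) in auto)
  have Cau: "Cauchy (\<lambda>n. ball_mean (s k) (v (r n)) x)" if x: "x \<in> D" for x k
  proof -
    obtain l where "(\<lambda>n. ball_mean (s k) (v (r n)) x / M k) \<longlonglongrightarrow> l" using r(2)[of "(x, k)"] x by auto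
    then have "(\<lambda>n. M k * (ball_mean (s k) (v (r n)) x / M k)) \<longlonglongrightarrow> M k * l" by (rule tendsto_mult_left)
    then show ?thesis using M[of k] LIMSEQ_imp_Cauchy by auto
  qed
  show thesis
  proof (rule that[OF r(1)], intro allI impI)
    fix d e :: real assume d: "0 < d" and e: "0 < e"
    \<comment> \<open>\<open>G + G\<close> is the energy bound of a difference of two members of the
      sequence.\<close>
    have "(\<lambda>k. ((G + G) * s k)\<^sup>2 / (d / 2)\<^sup>2) \<longlonglongrightarrow> ((G + G) * 0)\<^sup>2 / (d / 2)\<^sup>2"
      unfolding s_def using d LIMSEQ_inverse_real_of_nat by (intro tendsto_intros) (auto simp: inverse_eq_divide)
    then have "eventually (\<lambda>k. ((G + G) * s k)\<^sup>2 / (d / 2)\<^sup>2 < e) sequentially"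
      by (rule order_tendstoD(2)) (use e in simp)
    then obtain k where k: "((G + G) * s k)\<^sup>2 / (d / 2)\<^sup>2 < e" by (auto simp: eventually_sequentially)
    \<comment> \<open>Halved twice: differences of means are to be at most \<open>d / 2\<close>, and
      outside \<open>R\<close> each mean takes half of that.\<close>
    have "0 < d / 2 / 2" using d by simp
    obtain R where R: "\<And>u (x :: real^'n). energy_bounded c G u \<Longrightarrow> AE_block_radial m b u \<Longrightarrow> R \<le> norm x \<Longrightarrow> \<bar>ball_mean (s k) u x\<bar> \<le> d / 2 / 2"
      by (rule ball_mean_block_radial_decay[where c = c, OF N s[of k] \<open>0 < d / 2 / 2\<close> G blocks]) blast
    have d2: "0 < d / 2" using d by simp
    obtain n0 where n0: "\<forall>i\<ge>n0. \<forall>j\<ge>n0. \<forall>x. \<bar>ball_mean (s k) (v (r i)) x - ball_mean (s k) (v (r j)) x\<bar> \<le> d / 2"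
      by (rule ball_mean_uniformly_Cauchy[where v = "\<lambda>n. v (r n)", OF v s d2 R[OF v rad] D(2) Cau])
    have "emeasure lborel {x. d < \<bar>v (r i) x - v (r j) x\<bar>} \<le> ennreal e" if "n0 \<le> i" "n0 \<le> j" for i j
    proof -
      have "emeasure lborel {x. d < \<bar>v (r i) x - v (r j) x\<bar>} \<le> ennreal (((G + G) * s k)\<^sup>2 / (d / 2)\<^sup>2)"
        by (rule energy_bounded.emeasure_superlevel_le_ball_mean[OF energy_bounded_diff[OF v v] s d])
          (use n0 that in \<open>simp add: ball_mean_diff[OF v v s]\<close>)
      also have "\<dots> \<le> ennreal e" using k by (intro ennreal_leI) simp
      finally show ?thesis .
    qed
    then show "\<exists>n0. \<forall>i\<ge>n0. \<forall>j\<ge>n0. emeasure lborel {x. d < \<bar>v (r i) x - v (r j) x\<bar>} \<le> ennreal e" by blast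
  qed
qed

text \<open>The weak-type estimate is linear in \<open>G\<close>, which may be any number above
  \<open>D12_norm u\<close>; letting \<open>G\<close> decrease to the norm gives the bound, also
  when the norm is 0.\<close>

lemma D12_Lp_sum:
  fixes u :: "real^'n \<Rightarrow> real"
  assumes N: "3 \<le> CARD('n)" and u: "u \<in> D12"
    and pq: "1 < p" "p < critical_exp CARD('n)" "critical_exp CARD('n) < q"
  defines "a \<equiv> critical_exp CARD('n)"
  defines "K \<equiv> weak_const CARD('n)"
  defines "C \<equiv> (K * layer_const p (a - p)) powr (1 / p) + (K * layer_const a (q - a)) powr (1 / q)"
  shows "u \<in> Lp_sum p q" and "Lp_sum_norm p q u \<le> C * D12_norm u"
proof -
  obtain v where v: "AE x in lborel. u x = v x" "\<And>G. D12_norm u < G \<Longrightarrow> energy_bounded a G v"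
    using D12_borel_representative[OF N u] by (metis a_def)
  have um: "u \<in> borel_measurable lebesgue" using u by (auto simp: D12_def D12_approx_def Lp_def)
  have vm: "v \<in> borel_measurable borel" using energy_bounded.meas[OF v(2)[of "D12_norm u + 1"]] by simp
  have K: "0 \<le> K" unfolding K_def by (rule weak_const_nonneg)
  have weak: "emeasure lborel {x. l < \<bar>v x\<bar>} \<le> ennreal (K * (G / l) powr a)" if "D12_norm u < G" "0 < l" for G l
  proof -
    have "0 < G" using D12_norm_nonneg[OF N u] that by simp
    then show ?thesis
      using energy_bounded.weak_type[OF v(2)[OF that(1)] _ _ that(2)] N by (simp add: K_def a_def critical_exp_def)
  qed
  have pa: "0 < p" "p < a" "a < q" using pq by (auto simp: a_def)
  have G: "0 < D12_norm u + e" if "0 < e" for e using D12_norm_nonneg[OF N u] that by simp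
  show "u \<in> Lp_sum p q"
    by (rule Lp_sum_weak[OF um vm v(1) K G[of 1] weak pa]) auto
  have C: "0 \<le> C" unfolding C_def by simp
  show "Lp_sum_norm p q u \<le> C * D12_norm u"
  proof (rule field_le_epsilon)
    fix e :: real assume e: "0 < e"
    define e' where "e' = e / (C + 1)"
    have e': "0 < e'" using e C by (simp add: e'_def)
    have "Lp_sum_norm p q u \<le> C * (D12_norm u + e')"
      unfolding C_def by (rule Lp_sum_norm_weak_le[OF um vm v(1) K G[OF e'] weak pa]) (use e' in auto)
    also have "\<dots> = C * D12_norm u + e * (C / (C + 1))" using C by (simp add: e'_def distrib_left)
    also have "e * (C / (C + 1)) \<le> e" using C e by (intro mult_left_le) auto
    finally show "Lp_sum_norm p q u \<le> C * D12_norm u + e" by simp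
  qed
qed

text \<open>The work is done on Borel representatives: a subsequence is Cauchy in measure, its limit
  inherits the weak-type bound, and this bound together with convergence in measure gives
  convergence in the sum space.\<close>

lemma D12_s_compact:
  fixes u :: "nat \<Rightarrow> real^'n \<Rightarrow> real" and b :: "'n \<Rightarrow> nat"
  assumes N: "3 \<le> CARD('n)"
    and blocks: "\<And>j. b j \<in> {1..m}" "\<And>j. \<exists>j'. j' \<noteq> j \<and> b j' = b j"
    and pq: "1 < p" "p < critical_exp CARD('n)" "critical_exp CARD('n) < q"
    and u: "\<And>n. u n \<in> D12_s m b" and B: "\<And>n. D12_norm (u n) \<le> B"
  shows "\<exists>v\<in>Lp_sum p q. \<exists>r. strict_mono r \<and> (\<lambda>n. Lp_sum_norm p q (\<lambda>x. u (r n) x - v x)) \<longlonglongrightarrow> 0"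
proof -
  define a where "a = critical_exp CARD('n)"
  define K where "K = weak_const CARD('n)"
  \<comment> \<open>Positive and strictly above all the norms, as
    \<open>D12_borel_representative\<close> asks.\<close>
  define G where "G = B + 1"
  have uD: "u n \<in> D12" for n using u by (auto simp: D12_s_def)
  have G: "0 < G" using order_trans[OF D12_norm_nonneg[OF N uD[of 0]] B[of 0]] by (simp add: G_def)
  have pa: "0 < p" "p < a" "a < q" using pq by (auto simp: a_def)
  have K: "0 \<le> K" unfolding K_def by (rule weak_const_nonneg)
  have "\<exists>v. (AE x in lborel. u n x = v x) \<and> energy_bounded a G v" for n
  proof -
    obtain v where "AE x in lborel. u n x = v x" "\<And>G. D12_norm (u n) < G \<Longrightarrow> energy_bounded a G v"
      using D12_borel_representative[OF N uD] by (metis a_def)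
    moreover have "D12_norm (u n) < G" using B[of n] by (simp add: G_def)
    ultimately show ?thesis by blast
  qed
  then obtain v where uv: "\<And>n. AE x in lborel. u n x = v n x" and v: "\<And>n. energy_bounded a G (v n)" by metis
  note [measurable] = energy_bounded.meas[OF v]
  have rad: "AE_block_radial m b (v n)" for n
  proof -
    obtain w where w: "AE x in lebesgue. w x = u n x" "block_radial m b w" using u[of n] by (auto simp: D12_s_def)
    have "AE x in lborel. w x = u n x" using w(1) by (simp only: AE_completion_iff)
    with uv[of n] have "AE x in lborel. w x = v n x" by eventually_elim simp
    with w(2) show ?thesis by (auto simp: AE_block_radial_def)
  qed
  have um: "u n \<in> borel_measurable lebesgue" for n using uD[of n] by (auto simp: D12_def D12_approx_def Lp_def)
  have weak: "emeasure lborel {x. l < \<bar>w x\<bar>} \<le> ennreal (K * (H / l) powr a)"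
    if "energy_bounded a H w" "0 < H" "0 < l" for w :: "real^'n \<Rightarrow> real" and H l
    using energy_bounded.weak_type[OF that(1) _ that(2,3)] N by (simp add: K_def a_def critical_exp_def)
  obtain r where r: "strict_mono (r :: nat \<Rightarrow> nat)" and Cau: "\<forall>d>0. \<forall>e>0. \<exists>n0. \<forall>i\<ge>n0. \<forall>j\<ge>n0.
      emeasure lborel {x. d < \<bar>v (r i) x - v (r j) x\<bar>} \<le> ennreal e"
    by (rule block_radial_Cauchy_in_measure_subseq[where v = v, OF N v rad blocks])
  have vr: "v (r n) \<in> borel_measurable lborel" for n by simp
  obtain V r' where V [measurable]: "V \<in> borel_measurable borel" and r': "strict_mono r'"
    and lim: "AE x in lborel. (\<lambda>j. v (r (r' j)) x) \<longlonglongrightarrow> V x"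
    and conv: "\<And>d. 0 < d \<Longrightarrow> (\<lambda>n. emeasure lborel {x. d < \<bar>v (r n) x - V x\<bar>}) \<longlonglongrightarrow> 0"
  proof (rule Cauchy_in_measure_limit[where u = "\<lambda>n. v (r n)" and M = lborel])
    show "\<exists>n0. \<forall>i\<ge>n0. \<forall>j\<ge>n0. emeasure lborel {x \<in> space lborel. d < \<bar>v (r i) x - v (r j) x\<bar>} \<le> ennreal e"
      if "0 < d" "0 < e" for d e using Cau that by simp
  qed (use vr in auto)
  have Vm: "V \<in> borel_measurable lebesgue" by (rule measurable_completion) simp
  \<comment> \<open>\<open>V\<close> inherits the bound through the almost-everywhere convergent
    subsequence; no energy bound for \<open>V\<close> is established.\<close>
  have weakV: "emeasure lborel {x. l < \<bar>V x\<bar>} \<le> ennreal (K * (G / l) powr a)" if l: "0 < l" for l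
  proof -
    have "emeasure lborel {x \<in> space lborel. l < \<bar>V x\<bar>} \<le> ennreal (K * (G / l) powr a)"
      by (rule emeasure_superlevel_AE_limit[OF _ _ lim]) (use weak[OF v G l] in auto)
    then show ?thesis by simp
  qed
  \<comment> \<open>For fixed \<open>n\<close>, the limit over \<open>j\<close> of the bounds for
    \<open>v (r n) - v (r (r' j))\<close>, which have energy bound \<open>G + G\<close>.\<close>
  have weak_diff: "emeasure lborel {x. l < \<bar>v (r n) x - V x\<bar>} \<le> ennreal (K * (G + G) powr a * l powr - a)"
    if l: "0 < l" for l n
  proof -
    have lim': "AE x in lborel. (\<lambda>j. v (r n) x - v (r (r' j)) x) \<longlonglongrightarrow> v (r n) x - V x"
      using lim by eventually_elim (intro tendsto_intros)
    have "emeasure lborel {x \<in> space lborel. l < \<bar>v (r n) x - V x\<bar>} \<le> ennreal (K * ((G + G) / l) powr a)"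
      by (rule emeasure_superlevel_AE_limit[OF _ _ lim'])
        (use weak[OF energy_bounded_diff[OF v v] _ l] G in auto)
    then show ?thesis using G l by (simp add: powr_divide powr_minus_divide)
  qed
  have "V \<in> Lp_sum p q"
    by (rule Lp_sum_weak[OF Vm V _ K G weakV pa]) auto
  moreover have "(\<lambda>n. Lp_sum_norm p q (\<lambda>x. u (r n) x - V x)) \<longlonglongrightarrow> 0"
  proof (rule Lp_sum_norm_tendsto_weak[OF _ _ _ _ weak_diff conv pa])
    show "(\<lambda>x. u (r n) x - V x) \<in> borel_measurable lebesgue" for n using um Vm by simp
    show "AE x in lborel. u (r n) x - V x = v (r n) x - V x" for n using uv[of "r n"] by eventually_elim simp
    show "0 \<le> K * (G + G) powr a" using K by simp
  qed auto
  ultimately show ?thesis using r by blast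
qed

theorem theoremA1:
  fixes m :: nat and Nd :: "nat \<Rightarrow> nat" and b :: "'n::finite \<Rightarrow> nat" and p q :: real
  assumes "CARD('n) = (\<Sum>i=1..m. Nd i)"
    and "CARD('n) \<ge> 3"
    and "m \<ge> 1"
    and "\<And>i. i \<in> {1..m} \<Longrightarrow> Nd i \<ge> 2"
    and "\<And>i. i \<in> {1..m} \<Longrightarrow> card {j. b j = i} = Nd i"
    and "1 < p" and "p < critical_exp CARD('n)" and "critical_exp CARD('n) < q"
  shows "compactly_embedded (D12_s m b) D12_norm
           (Lp_sum p q :: (real^'n \<Rightarrow> real) set) (Lp_sum_norm p q)"
proof -
  \<comment> \<open>The block sizes add up to the dimension, so the blocks exhaust the coordinates
    and \<open>b\<close> takes values in \<open>{1..m}\<close> only.\<close>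
  have "card (\<Union>i\<in>{1..m}. {j. b j = i}) = (\<Sum>i=1..m. card {j. b j = i})"
    by (rule card_UN_disjoint) auto
  also have "\<dots> = CARD('n)" using assms(1,5) by simp
  finally have "(\<Union>i\<in>{1..m}. {j. b j = i}) = UNIV"
    by (rule card_subset_eq[OF finite subset_UNIV])
  then have "j \<in> (\<Union>i\<in>{1..m}. {j. b j = i})" for j by simp
  then have b1: "b j \<in> {1..m}" for j by auto
  \<comment> \<open>\<open>Nd i \<ge> 2\<close> enters: every coordinate has a partner in its block,
    the second direction of the circle in \<open>block_sphere_points\<close>.\<close>
  have b2: "\<exists>j'. j' \<noteq> j \<and> b j' = b j" for j
  proof (rule ccontr)
    assume "\<not> ?thesis"
    then have "{j'. b j' = b j} = {j}" by auto
    then show False using assms(4,5)[OF b1[of j]] by simp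
  qed
  note emb = D12_Lp_sum[OF assms(2) _ assms(6-8)]
  show ?thesis
    unfolding compactly_embedded_def
  proof (intro conjI)
    show "D12_s m b \<subseteq> Lp_sum p q" using emb(1) by (auto simp: D12_s_def)
    show "\<exists>C. \<forall>u\<in>D12_s m b. Lp_sum_norm p q u \<le> C * D12_norm u"
      by (rule exI, rule ballI, rule emb(2)) (simp add: D12_s_def)
    show "\<forall>u :: nat \<Rightarrow> real^'n \<Rightarrow> real. (\<forall>n. u n \<in> D12_s m b) \<and> (\<exists>B. \<forall>n. D12_norm (u n) \<le> B) \<longrightarrow>
        (\<exists>v\<in>Lp_sum p q. \<exists>r. strict_mono r \<and> (\<lambda>n. Lp_sum_norm p q (\<lambda>x. u (r n) x - v x)) \<longlonglongrightarrow> 0)"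
    proof (intro allI impI, elim conjE exE)
      fix u :: "nat \<Rightarrow> real^'n \<Rightarrow> real" and B :: real
      assume "\<forall>n. u n \<in> D12_s m b" "\<forall>n. D12_norm (u n) \<le> B"
      then have u: "u n \<in> D12_s m b" and B: "D12_norm (u n) \<le> B" for n by auto
      show "\<exists>v\<in>Lp_sum p q. \<exists>r. strict_mono r \<and> (\<lambda>n. Lp_sum_norm p q (\<lambda>x. u (r n) x - v x)) \<longlonglongrightarrow> 0"
        by (rule D12_s_compact[OF assms(2) b1 b2 assms(6-8) u B])
    qed
  qed
qed

end
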